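(* Every quasi-line graph $G$ satisfies $\chi_{\mathrm{pcf}}(G)\le \Delta(G)+4$.
   Context: Graphs are finite and simple. A graph $G$ is quasi-line if for every $v\in V(G)$ the neighborhood $N(v)$ is the union of two cliques. $\Delta(G)$ is the maximum degree. A proper conflict-free coloring of $G$ is a proper vertex coloring in which, for every non-isolated vertex $v$, some color appears exactly once in the open neighborhood $N(v)$. $\chi_{\mathrm{pcf}}(G)$ is the least $k$ such that $G$ has a proper conflict-free coloring with $k$ colors. *)

theory Defs
  imports Main "Graph_Theory.Pair_Digraph"
begin

text \<open>
  A finite simple graph is a \<^locale>\<open>pair_graph\<close>: a finite vertex set with a symmetric, loopless
  set of ordered pairs as adjacency relation. Each undirected edge is represented by both of its
  orientations, so degrees are counted as cardinalities of neighborhoods.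
\<close>

definition nbhd :: "'a pair_pre_digraph \<Rightarrow> 'a \<Rightarrow> 'a set" where
  "nbhd G v = {u. (v, u) \<in> parcs G}"

definition clique :: "'a pair_pre_digraph \<Rightarrow> 'a set \<Rightarrow> bool" where
  "clique G K \<longleftrightarrow> K \<subseteq> pverts G \<and> (\<forall>u\<in>K. \<forall>w\<in>K. u \<noteq> w \<longrightarrow> (u, w) \<in> parcs G)"

definition quasi_line :: "'a pair_pre_digraph \<Rightarrow> bool" where
  "quasi_line G \<longleftrightarrow>
     (\<forall>v\<in>pverts G. \<exists>A B. clique G A \<and> clique G B \<and> nbhd G v = A \<union> B)"

text \<open>The inserted 0 only matters for the graph without vertices, whose maximum degree is 0.\<close>

definition max_degree :: "'a pair_pre_digraph \<Rightarrow> nat" where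
  "max_degree G = Max (insert 0 ((\<lambda>v. card (nbhd G v)) ` pverts G))"

definition proper_coloring :: "'a pair_pre_digraph \<Rightarrow> ('a \<Rightarrow> 'c) \<Rightarrow> bool" where
  "proper_coloring G c \<longleftrightarrow> (\<forall>(u, w)\<in>parcs G. c u \<noteq> c w)"

definition pcf_coloring :: "'a pair_pre_digraph \<Rightarrow> ('a \<Rightarrow> 'c) \<Rightarrow> bool" where
  "pcf_coloring G c \<longleftrightarrow> proper_coloring G c \<and>
     (\<forall>v\<in>pverts G. nbhd G v \<noteq> {} \<longrightarrow> (\<exists>a. \<exists>!u. u \<in> nbhd G v \<and> c u = a))"

text \<open>As usual, a coloring with \<open>k\<close> colors need not use all of them.\<close>

definition pcf_colorable :: "'a pair_pre_digraph \<Rightarrow> nat \<Rightarrow> bool" where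
  "pcf_colorable G k \<longleftrightarrow> (\<exists>c. c ` pverts G \<subseteq> {..<k} \<and> pcf_coloring G c)"

definition chi_pcf :: "'a pair_pre_digraph \<Rightarrow> nat" where
  "chi_pcf G = (LEAST k. pcf_colorable G k)"

text \<open>Giving all vertices different colors shows that the minimum is over a nonempty set.\<close>

lemma pcf_colorable_card:
  assumes "pair_graph G"
  shows "pcf_colorable G (card (pverts G))"
proof -
  interpret pair_graph G by fact
  obtain c :: "'a \<Rightarrow> nat" where c: "bij_betw c (pverts G) {..<card (pverts G)}"
    using ex_bij_betw_finite_nat[OF pair_finite_verts] by (auto simp: lessThan_atLeast0)
  then have inj: "inj_on c (pverts G)"
    by (rule bij_betw_imp_inj_on)
  have nbhd: "nbhd G v \<subseteq> pverts G" for v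
    by (auto simp: nbhd_def dest: in_arcsD2)
  have "proper_coloring G c"
    unfolding proper_coloring_def
  proof (clarify)
    fix u w assume uw: "(u, w) \<in> parcs G" "c u = c w"
    then have "u = w"
      using inj by (meson in_arcsD1 in_arcsD2 inj_onD)
    with pair_no_loops[OF uw(1)] show False by simp
  qed
  moreover have "\<exists>a. \<exists>!u. u \<in> nbhd G v \<and> c u = a" if ne: "nbhd G v \<noteq> {}" for v
  proof -
    obtain u where u: "u \<in> nbhd G v" using ne by blast
    have "w = u" if "w \<in> nbhd G v" "c w = c u" for w
      using inj that u nbhd[of v] by (meson inj_onD subsetD)
    with u show ?thesis by blast
  qed
  ultimately have "pcf_coloring G c"
    by (simp add: pcf_coloring_def)
  then show ?thesis
    using bij_betw_imp_surj_on[OF c] unfolding pcf_colorable_def by blast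
qed

lemma pcf_colorable_chi_pcf:
  "pair_graph G \<Longrightarrow> pcf_colorable G (chi_pcf G)"
  unfolding chi_pcf_def by (rule LeastI, rule pcf_colorable_card)

end

theory Submission
  imports Defs
begin

text \<open>
  Let \<open>D\<close> be the maximum degree. The vertices are split into \<open>K = D div 2 + 2\<close> classes such that
  every vertex has at most one neighbor (its mate) in its own class, and each class is split into
  two colors by a bit that separates mates; this uses \<open>2 * K \<le> D + 4\<close> colors. A vertex with a
  mate sees the color of its mate once. If \<open>v\<close> has no mate (\<open>v\<close> is solo) and the two cliques
  covering its neighborhood meet some class in different numbers of vertices, then a color of that
  class occurs once around \<open>v\<close>. For the other solo vertices, called balanced, the bits must separate
  the two neighbors in a class that meets both cliques in a single vertex; \<open>v\<close> is poor if it does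
  not have two such classes.

  A partition that minimizes first the number of edges inside classes and then the number of poor
  vertices has no poor vertex: moving one of two mates around a poor vertex to another class creates
  new poor vertices, and three such moves contradict each other. Among the partitions without poor
  vertices, one with the most mates has an independent set of balanced vertices. Then the
  requirements on the bits (two alternatives per balanced vertex, one requirement per pair of mates)
  are the edges of a graph of maximum degree two. Each of its cycles contains alternatives of two
  balanced vertices, so every cycle can be broken by dropping an alternative, at most one per
  vertex, and the bits are read off the remaining forest.

  The argument needs that no neighborhood consists of two nonadjacent vertices \<open>x\<close>, \<open>y\<close>. Such a
  vertex is removed beforehand and replaced by an edge from \<open>x\<close> to \<open>y\<close>.
\<close>

section \<open>Partitions into classes\<close>

text \<open>\<open>N\<close> is total; \<open>N_sub\<close> and \<open>sym\<close> make it empty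
  outside \<open>V\<close>. The assumption \<open>no1\<close> forces at least two vertices into each
  of the two cliques around a balanced vertex that has neighbors.\<close>

locale clique_cover =
  fixes V :: "'a set" and N A B :: "'a \<Rightarrow> 'a set" and D :: nat
  assumes fin: "finite V"
    and N_sub: "N v \<subseteq> V"
    and sym: "u \<in> N v \<Longrightarrow> v \<in> N u"
    and irr: "v \<notin> N v"
    and N_eq: "N v = A v \<union> B v"
    and disj: "A v \<inter> B v = {}"
    and clA: "u \<in> A v \<Longrightarrow> w \<in> A v \<Longrightarrow> u \<noteq> w \<Longrightarrow> w \<in> N u"
    and clB: "u \<in> B v \<Longrightarrow> w \<in> B v \<Longrightarrow> u \<noteq> w \<Longrightarrow> w \<in> N u"
    and no1: "\<not> (card (A v) = 1 \<and> card (B v) = 1)"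
    and deg: "card (N v) \<le> D"
begin

text \<open>\<open>2 * K \<le> D + 4\<close> allows two colors per class, while
  \<open>D < 2 * K - 2\<close> leaves room for pigeonhole arguments on the classes.\<close>

definition K :: nat where "K = D div 2 + 2"

definition part :: "('a \<Rightarrow> nat) \<Rightarrow> 'a \<Rightarrow> nat \<Rightarrow> 'a set" where
  "part p v c = {u \<in> N v. p u = c}"

definition mates :: "('a \<Rightarrow> nat) \<Rightarrow> 'a \<Rightarrow> 'a set" where
  "mates p v = part p v (p v)"

text \<open>\<open>side\<close> and \<open>opp\<close> make arguments about a neighbor
  \<open>u\<close> of \<open>v\<close> independent of which of the two cliques contains
  \<open>u\<close>.\<close>

definition side :: "'a \<Rightarrow> 'a \<Rightarrow> 'a set" where
  "side v u = (if u \<in> A v then A v else B v)"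

definition opp :: "'a \<Rightarrow> 'a \<Rightarrow> 'a set" where
  "opp v u = (if u \<in> A v then B v else A v)"

definition balanced :: "('a \<Rightarrow> nat) \<Rightarrow> 'a \<Rightarrow> bool" where
  "balanced p v \<longleftrightarrow> (\<forall>c. card {u \<in> A v. p u = c} = card {u \<in> B v. p u = c})"

definition poor :: "('a \<Rightarrow> nat) \<Rightarrow> 'a \<Rightarrow> bool" where
  "poor p v \<longleftrightarrow> N v \<noteq> {} \<and> mates p v = {} \<and> balanced p v \<and>
     (\<forall>c c'. card {u \<in> A v. p u = c} = 1 \<longrightarrow> card {u \<in> A v. p u = c'} = 1 \<longrightarrow> c = c')"

lemma nbr_sym: "u \<in> N v \<longleftrightarrow> v \<in> N u"
  using sym by blast

lemma nbr_neq: "u \<in> N v \<Longrightarrow> u \<noteq> v"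
  using irr by blast

lemma N_V: "u \<in> N v \<Longrightarrow> u \<in> V" "u \<in> N v \<Longrightarrow> v \<in> V"
  using N_sub sym by blast+

lemma finN [simp]: "finite (N v)" "finite (A v)" "finite (B v)" "finite (part p v c)" "finite (mates p v)"
proof -
  show "finite (N v)" using N_sub fin by (rule finite_subset)
  then show "finite (A v)" "finite (B v)" "finite (part p v c)" "finite (mates p v)"
    using N_eq[of v] by (auto simp: part_def mates_def)
qed

lemma fin_side [simp]: "finite (side v u)" "finite (opp v u)"
  by (auto simp: side_def opp_def)

lemma side_in: "u \<in> N v \<Longrightarrow> u \<in> side v u"
  using N_eq[of v] by (auto simp: side_def)

lemma side_opp: "N v = side v u \<union> opp v u" "side v u \<inter> opp v u = {}"
  using N_eq[of v] disj[of v] by (auto simp: side_def opp_def)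

lemma side_cl: "x \<in> side v u \<Longrightarrow> y \<in> side v u \<Longrightarrow> x \<noteq> y \<Longrightarrow> y \<in> N x"
  using clA[of x v y] clB[of x v y] by (auto simp: side_def split: if_splits)

lemma opp_cl: "x \<in> opp v u \<Longrightarrow> y \<in> opp v u \<Longrightarrow> x \<noteq> y \<Longrightarrow> y \<in> N x"
  using clA[of x v y] clB[of x v y] by (auto simp: opp_def split: if_splits)

lemma balanced_side: "balanced p v \<Longrightarrow> card {x \<in> side v u. p x = c} = card {x \<in> opp v u. p x = c}"
  by (auto simp: balanced_def side_def opp_def)

lemma part_side: "part p v c = {x \<in> side v u. p x = c} \<union> {x \<in> opp v u. p x = c}"
  "{x \<in> side v u. p x = c} \<inter> {x \<in> opp v u. p x = c} = {}"
  using side_opp[of v u] by (auto simp: part_def)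

lemma card_part: "card (part p v c) = card {x \<in> A v. p x = c} + card {x \<in> B v. p x = c}"
proof -
  have "part p v c = {x \<in> A v. p x = c} \<union> {x \<in> B v. p x = c}"
    using N_eq[of v] by (auto simp: part_def)
  then show ?thesis using disj[of v] by (simp add: card_Un_disjoint disjoint_iff)
qed

lemma balanced_card_part: "balanced p v \<Longrightarrow> card (part p v c) = 2 * card {x \<in> A v. p x = c}"
  by (simp add: card_part balanced_def)

lemma balanced_even: "balanced p v \<Longrightarrow> even (card (part p v c))"
  by (simp add: balanced_card_part)

lemma in_mates: "u \<in> mates p v \<longleftrightarrow> u \<in> N v \<and> p u = p v"
  by (auto simp: mates_def part_def)

lemma in_part: "u \<in> part p v c \<longleftrightarrow> u \<in> N v \<and> p u = c"
  by (auto simp: part_def)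

lemma in_mates_sym: "u \<in> mates p v \<longleftrightarrow> v \<in> mates p u"
  using nbr_sym by (auto simp: in_mates)

section \<open>Edges inside classes and edge-minimal partitions\<close>

definition mono_pairs :: "('a \<Rightarrow> nat) \<Rightarrow> ('a \<times> 'a) set" where
  "mono_pairs p = {(u, w). w \<in> mates p u}"

lemma fin_mono_pairs: "finite (mono_pairs p)"
proof (rule finite_subset)
  show "mono_pairs p \<subseteq> V \<times> V" using N_V by (auto simp: mono_pairs_def in_mates)
qed (use fin in simp)

text \<open>Every edge is counted in both orientations, hence the factor 2. The pairs avoiding
  \<open>v\<close> are split off because moving \<open>v\<close> leaves them alone.\<close>

lemma card_mono_pairs:
  "card (mono_pairs p) = card {(u, w). w \<in> mates p u \<and> u \<noteq> v \<and> w \<noteq> v} + 2 * card (mates p v)"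
proof -
  let ?R = "{(u, w). w \<in> mates p u \<and> u \<noteq> v \<and> w \<noteq> v}"
  have eq: "mono_pairs p = ?R \<union> ({v} \<times> mates p v \<union> mates p v \<times> {v})"
    using in_mates_sym[of _ p v] by (auto simp: mono_pairs_def)
  have "finite ?R" by (rule finite_subset[OF _ fin_mono_pairs[of p]]) (auto simp: mono_pairs_def)
  moreover have "v \<notin> mates p v" by (simp add: in_mates irr)
  moreover have "card ({v} \<times> mates p v \<union> mates p v \<times> {v}) = card ({v} \<times> mates p v) + card (mates p v \<times> {v})"
    using \<open>v \<notin> mates p v\<close> by (intro card_Un_disjoint) auto
  moreover have "card (?R \<union> ({v} \<times> mates p v \<union> mates p v \<times> {v})) =
      card ?R + card ({v} \<times> mates p v \<union> mates p v \<times> {v})"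
    using \<open>finite ?R\<close> by (intro card_Un_disjoint) auto
  ultimately show ?thesis unfolding eq by (simp add: card_cartesian_product)
qed

lemma mates_upd_self: "mates (p(v := c)) v = part p v c"
  using irr[of v] by (auto simp: in_mates in_part split: if_splits)

lemma card_mono_pairs_upd:
  "card (mono_pairs (p(v := c))) + 2 * card (mates p v) = card (mono_pairs p) + 2 * card (part p v c)"
proof -
  have "{(u, w). w \<in> mates (p(v := c)) u \<and> u \<noteq> v \<and> w \<noteq> v} = {(u, w). w \<in> mates p u \<and> u \<noteq> v \<and> w \<noteq> v}"
    by (auto simp: in_mates)
  then show ?thesis
    using card_mono_pairs[of p v] card_mono_pairs[of "p(v := c)" v] by (simp add: mates_upd_self)
qed

definition in_range :: "('a \<Rightarrow> nat) \<Rightarrow> bool" where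
  "in_range p \<longleftrightarrow> (\<forall>v\<in>V. p v < K)"

definition edge_minimal :: "('a \<Rightarrow> nat) \<Rightarrow> bool" where
  "edge_minimal p \<longleftrightarrow> in_range p \<and> (\<forall>q. in_range q \<longrightarrow> card (mono_pairs p) \<le> card (mono_pairs q))"

lemma in_range_upd: "in_range p \<Longrightarrow> c < K \<Longrightarrow> in_range (p(v := c))"
  by (auto simp: in_range_def)

text \<open>Moving \<open>v\<close> to class \<open>c\<close> exchanges its mates for
  \<open>part p v c\<close>, and by minimality this cannot lower the number of inside edges.\<close>

lemma edge_minimal_le: "edge_minimal p \<Longrightarrow> c < K \<Longrightarrow> card (mates p v) \<le> card (part p v c)"
proof -
  assume p: "edge_minimal p" and c: "c < K"
  have "card (mono_pairs p) \<le> card (mono_pairs (p(v := c)))"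
    using p in_range_upd[of p c v] c unfolding edge_minimal_def by blast
  then show ?thesis using card_mono_pairs_upd[of p v c] by linarith
qed

text \<open>A move that adds no inside edges stays at the minimum. Such moves produce all the
  alternative partitions in \<open>poor_core\<close>.\<close>

lemma edge_minimal_upd: "edge_minimal p \<Longrightarrow> c < K \<Longrightarrow> card (part p v c) \<le> card (mates p v) \<Longrightarrow> edge_minimal (p(v := c))"
proof -
  assume p: "edge_minimal p" and c: "c < K" and le: "card (part p v c) \<le> card (mates p v)"
  have "card (mono_pairs (p(v := c))) \<le> card (mono_pairs p)"
    using card_mono_pairs_upd[of p v c] le by linarith
  then show ?thesis using p in_range_upd[of p c v] c unfolding edge_minimal_def by (meson le_trans)
qed

lemma sum_part: "in_range p \<Longrightarrow> (\<Sum>c<K. card (part p v c)) = card (N v)"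
proof -
  assume "in_range p"
  then have "(\<Union>c\<in>{..<K}. part p v c) = N v" using N_V by (auto simp: part_def in_range_def)
  moreover have "card (\<Union>c\<in>{..<K}. part p v c) = (\<Sum>c<K. card (part p v c))"
    by (intro card_UN_disjoint) (auto simp: part_def)
  ultimately show ?thesis by simp
qed

lemma D_lt: "D < 2 * K - 2" "2 \<le> K" by (auto simp: K_def)

text \<open>With two mates, \<open>v\<close> would have two neighbors in each of the
  \<open>K\<close> classes, more than \<open>D\<close> in total.\<close>

lemma edge_minimal_mates: "edge_minimal p \<Longrightarrow> card (mates p v) \<le> 1"
proof (rule ccontr)
  assume p: "edge_minimal p" and "\<not> card (mates p v) \<le> 1"
  then have "2 \<le> card (part p v c)" if "c < K" for c
    using edge_minimal_le[OF p that, of v] by linarith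
  then have "(\<Sum>c<K. (2::nat)) \<le> (\<Sum>c<K. card (part p v c))" by (intro sum_mono) auto
  then show False using sum_part[of p v] p deg[of v] D_lt by (simp add: edge_minimal_def)
qed

section \<open>Classes that are absent around balanced and poor vertices\<close>

lemma balanced_cards: "balanced p v \<Longrightarrow> in_range p \<Longrightarrow> card (A v) = card (B v)"
proof -
  assume b: "balanced p v" and p: "in_range p"
  have "card X = (\<Sum>c<K. card {x \<in> X. p x = c})" if "X \<subseteq> N v" for X
  proof -
    have "(\<Union>c\<in>{..<K}. {x \<in> X. p x = c}) = X" using p that N_V by (auto simp: in_range_def)
    moreover have "finite X" using that finN(1) by (rule finite_subset)
    moreover have "card (\<Union>c\<in>{..<K}. {x \<in> X. p x = c}) = (\<Sum>c<K. card {x \<in> X. p x = c})"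
      using \<open>finite X\<close> by (intro card_UN_disjoint) auto
    ultimately show ?thesis by simp
  qed
  from this[of "A v"] this[of "B v"] show ?thesis using b N_eq[of v] by (simp add: balanced_def)
qed

lemma card_AB: "card (N v) = card (A v) + card (B v)"
  using N_eq[of v] disj[of v] by (simp add: card_Un_disjoint)

lemma balanced_cardA: "balanced p v \<Longrightarrow> in_range p \<Longrightarrow> card (A v) + 2 \<le> K"
  using balanced_cards[of p v] card_AB[of v] deg[of v] by (simp add: K_def)

lemma balanced_part_A: "balanced p v \<Longrightarrow> part p v c \<noteq> {} \<longleftrightarrow> {x \<in> A v. p x = c} \<noteq> {}"
proof -
  assume "balanced p v"
  then have "card (part p v c) = 0 \<longleftrightarrow> card {x \<in> A v. p x = c} = 0"
    using balanced_card_part[of p v c] by simp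
  then show ?thesis by (simp only: card_eq_0_iff) simp
qed

text \<open>Every class seen by a balanced vertex meets \<open>A v\<close>, and \<open>A v\<close>
  has only half of the neighbors.\<close>

lemma balanced_seen: "balanced p v \<Longrightarrow> in_range p \<Longrightarrow> card {c. part p v c \<noteq> {}} + 2 \<le> K"
proof -
  assume b: "balanced p v" and p: "in_range p"
  have "{c. part p v c \<noteq> {}} = p ` A v" using balanced_part_A[OF b] by auto
  then have "card {c. part p v c \<noteq> {}} \<le> card (A v)" by (simp add: card_image_le)
  then show ?thesis using balanced_cardA[OF b p] by simp
qed

definition absent :: "('a \<Rightarrow> nat) \<Rightarrow> 'a \<Rightarrow> nat set" where
  "absent p v = {c. c < K \<and> part p v c = {}}"

lemma fin_absent [simp]: "finite (absent p v)" by (simp add: absent_def)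

lemma card_absent: "in_range p \<Longrightarrow> card (absent p v) + card {c. part p v c \<noteq> {}} = K"
proof -
  assume p: "in_range p"
  have s: "{c. part p v c \<noteq> {}} \<subseteq> {..<K}" using p N_V by (auto simp: part_def in_range_def)
  have "absent p v \<union> {c. part p v c \<noteq> {}} = {..<K}" using s by (auto simp: absent_def)
  moreover have "card (absent p v \<union> {c. part p v c \<noteq> {}}) = card (absent p v) + card {c. part p v c \<noteq> {}}"
    using finite_subset[OF s] by (intro card_Un_disjoint) (auto simp: absent_def)
  ultimately show ?thesis by simp
qed

text \<open>For a solo vertex one of these classes is its own; the second one is a class to which it
  can move without gaining mates.\<close>

lemma balanced_absent2: "balanced p v \<Longrightarrow> in_range p \<Longrightarrow> 2 \<le> card (absent p v)"
  using balanced_seen[of p v] card_absent[of p v] by linarith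

definition near_proper :: "('a \<Rightarrow> nat) \<Rightarrow> bool" where
  "near_proper p \<longleftrightarrow> in_range p \<and> (\<forall>v. card (mates p v) \<le> 1)"

lemma edge_minimal_near_proper: "edge_minimal p \<Longrightarrow> near_proper p"
  using edge_minimal_mates by (auto simp: near_proper_def edge_minimal_def)

lemma balanced_A2: "balanced p v \<Longrightarrow> in_range p \<Longrightarrow> N v \<noteq> {} \<Longrightarrow> 2 \<le> card (A v)"
proof -
  assume b: "balanced p v" "in_range p" "N v \<noteq> {}"
  have "card (N v) \<noteq> 0" using b(3) by simp
  then have "card (A v) \<noteq> 0" using balanced_cards[OF b(1,2)] card_AB[of v] by simp
  moreover have "card (A v) \<noteq> 1" using balanced_cards[OF b(1,2)] no1[of v] by auto
  ultimately show ?thesis by linarith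
qed

text \<open>Each of three vertices of one class in a clique would have two mates.\<close>

lemma near_proper_cl2:
  assumes "near_proper p" shows "card {x \<in> A v. p x = c} \<le> 2"
proof (rule ccontr)
  assume a: "\<not> ?thesis"
  then have "{x \<in> A v. p x = c} \<noteq> {}" by (metis card.empty zero_le)
  then obtain x where x: "x \<in> A v" "p x = c" by blast
  have "{y \<in> A v. p y = c} - {x} \<subseteq> mates p x" using clA[OF x(1)] x(2) by (fastforce simp: in_mates)
  then have "card ({x \<in> A v. p x = c} - {x}) \<le> card (mates p x)" by (intro card_mono) auto
  also have "\<dots> \<le> 1" using assms by (simp add: near_proper_def)
  finally show False using a x by simp
qed

lemma poor_single:
  "poor p v \<Longrightarrow> card {u \<in> A v. p u = c} = 1 \<Longrightarrow> card {u \<in> A v. p u = c'} = 1 \<Longrightarrow> c = c'"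
  unfolding poor_def by blast

text \<open>With at most one exception, the classes that meet \<open>A v\<close> contain at least
  two of its vertices, so only about half of \<open>card (A v)\<close> classes are seen. Since
  \<open>card (A v)\<close> is at least 2, this gains one class over
  \<open>balanced_absent2\<close>.\<close>

lemma poor_absent3: "poor p v \<Longrightarrow> near_proper p \<Longrightarrow> 3 \<le> card (absent p v)"
proof -
  assume v: "poor p v" "near_proper p"
  then have p: "in_range p" and b: "balanced p v" and ne: "N v \<noteq> {}" by (simp_all add: poor_def near_proper_def)
  have one: "c = c'" if "card {u \<in> A v. p u = c} = 1" "card {u \<in> A v. p u = c'} = 1" for c c'
    by (rule poor_single[OF v(1) that])
  let ?S = "p ` A v" and ?f = "\<lambda>c. card {x \<in> A v. p x = c}"
  have S: "{c. part p v c \<noteq> {}} = ?S" unfolding balanced_part_A[OF b] by blast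
  have sum: "card (A v) = (\<Sum>c\<in>?S. ?f c)"
    using sum.image_gen[OF finN(2), of "\<lambda>_. 1::nat" v p] by (simp only: card_eq_sum)
  have pos: "1 \<le> ?f c" if c: "c \<in> ?S" for c
  proof -
    have "{x \<in> A v. p x = c} \<noteq> {}" using c by blast
    then have "?f c \<noteq> 0" by simp
    then show ?thesis by linarith
  qed
  \<comment> \<open>The \<open>+ 1\<close> accounts for the one class that may meet
    \<open>A v\<close> in a single vertex.\<close>
  have "2 * card ?S \<le> (\<Sum>c\<in>?S. ?f c) + 1" (is "_ \<le> ?s + 1")
  proof (cases "\<exists>c\<in>?S. ?f c = 1")
    case True
    then obtain c where c: "c \<in> ?S" "?f c = 1" by blast
    have "2 \<le> ?f d" if "d \<in> ?S - {c}" for d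
    proof -
      have "?f d \<noteq> 1" using one[OF c(2), of d] that by blast
      moreover have "1 \<le> ?f d" using pos that by blast
      ultimately show ?thesis by linarith
    qed
    then have "(\<Sum>d\<in>?S - {c}. 2) \<le> (\<Sum>d\<in>?S - {c}. ?f d)" by (rule sum_mono)
    moreover have "(\<Sum>d\<in>?S. ?f d) = ?f c + (\<Sum>d\<in>?S - {c}. ?f d)"
      using c by (intro sum.remove) auto
    moreover have "card ?S = 1 + card (?S - {c})" using c(1) card.remove[of ?S c] by simp
    ultimately show ?thesis using c(2) by simp
  next
    case False
    then have "2 \<le> ?f d" if "d \<in> ?S" for d
    proof -
      have "?f d \<noteq> 1" using False that by blast
      then show ?thesis using pos[OF that] by linarith
    qed
    then have "(\<Sum>d\<in>?S. 2) \<le> (\<Sum>d\<in>?S. ?f d)" by (rule sum_mono)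
    then show ?thesis by simp
  qed
  then have "2 * card ?S \<le> card (A v) + 1" using sum by linarith
  moreover have "card (absent p v) + card ?S = K" using card_absent[OF p, of v] by (simp only: S)
  ultimately show ?thesis using balanced_cardA[OF b p] balanced_A2[OF b p ne] by linarith
qed

section \<open>Solo neighbors and the locality of poorness\<close>

lemma solo_side:
  assumes "mates q w = {}" "w \<in> N z"
  shows "{x \<in> side z w. q x = q w} = {w}"
proof -
  have "x = w" if "x \<in> side z w" "q x = q w" for x
    using side_cl[OF side_in[OF assms(2)] that(1)] that(2) in_mates[of x q w] assms(1) by blast
  then show ?thesis using side_in[OF assms(2)] by auto
qed

text \<open>By \<open>solo_side\<close>, \<open>w\<close> is alone with its class in its own clique;
  if that clique is \<open>B z\<close>, balance transfers the count to \<open>A z\<close>.\<close>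

lemma solo_single:
  assumes "balanced q z" "w \<in> N z" "mates q w = {}"
  shows "card {x \<in> A z. q x = q w} = 1"
proof -
  have "card {x \<in> side z w. q x = q w} = 1" using solo_side[OF assms(3,2)] by simp
  then show ?thesis using balanced_side[OF assms(1), of w "q w"]
    by (auto simp: side_def opp_def split: if_splits)
qed

text \<open>Both classes meet \<open>A y\<close> in a single vertex, and a poor vertex has only one
  such class. Together with \<open>solo_adj\<close>, adjacent solo neighbors of a poor vertex give a
  contradiction.\<close>

lemma poor_solos:
  assumes "poor q y" "u \<in> N y" "mates q u = {}" "u' \<in> N y" "mates q u' = {}"
  shows "q u = q u'"
proof -
  have "balanced q y" using assms(1) by (simp add: poor_def)
  from solo_single[OF this assms(2,3)] solo_single[OF this assms(4,5)] show ?thesis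
    by (rule poor_single[OF assms(1)])
qed

lemma solo_adj: "mates q u = {} \<Longrightarrow> w \<in> N u \<Longrightarrow> q u \<noteq> q w"
  by (auto simp: in_mates)

lemma A_nbr: "u \<in> A z \<Longrightarrow> u \<in> N z" and B_nbr: "u \<in> B z \<Longrightarrow> u \<in> N z"
  using N_eq[of z] by auto

lemma cl_cong:
  assumes "\<And>u. u \<in> N z \<Longrightarrow> p u = q u"
  shows "{u \<in> A z. p u = c} = {u \<in> A z. q u = c}" "{u \<in> B z. p u = c} = {u \<in> B z. q u = c}"
  using assms A_nbr B_nbr by auto

lemma balanced_cong: "(\<And>u. u \<in> N z \<Longrightarrow> p u = q u) \<Longrightarrow> balanced p z \<longleftrightarrow> balanced q z"
  unfolding balanced_def by (simp only: cl_cong[of z p q])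

lemma mates_cong: "(\<And>u. u \<in> N z \<Longrightarrow> p u = q u) \<Longrightarrow> p z = q z \<Longrightarrow> mates p z = mates q z"
  by (auto simp: in_mates)

text \<open>Poorness depends only on the classes of \<open>z\<close> and its neighbors, so a move
  can create poor vertices only at or next to the moved vertices.\<close>

lemma poor_cong: "(\<And>u. u \<in> N z \<Longrightarrow> p u = q u) \<Longrightarrow> p z = q z \<Longrightarrow> poor p z \<longleftrightarrow> poor q z"
  unfolding poor_def by (simp only: cl_cong[of z p q] mates_cong[of z p q] balanced_cong[of z p q])

lemma poor_cong_imp: "poor q z \<Longrightarrow> (\<And>u. u \<in> N z \<Longrightarrow> q u = p u) \<Longrightarrow> q z = p z \<Longrightarrow> poor p z"
  by (simp only: poor_cong[of z p q])

lemma balancedD: "balanced p v \<Longrightarrow> card {u \<in> B v. p u = c} = card {u \<in> A v. p u = c}"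
  by (simp add: balanced_def)

lemma mates_empty: "mates p v = {} \<longleftrightarrow> (\<forall>u\<in>N v. p u \<noteq> p v)"
  by (auto simp: mates_def part_def)

lemma edge_minimal_in_range: "edge_minimal p \<Longrightarrow> in_range p" by (simp add: edge_minimal_def)

text \<open>Moving \<open>x\<close> to a class that it does not see would lose the edges to its
  mates.\<close>

lemma edge_minimal_matched:
  assumes "edge_minimal p" "mates p x \<noteq> {}" "c < K" shows "part p x c \<noteq> {}"
proof
  assume "part p x c = {}"
  then show False using edge_minimal_le[OF assms(1,3), of x] assms(2) by simp
qed

lemma edge_minimal_sees: "edge_minimal p \<Longrightarrow> u \<in> mates p x \<Longrightarrow> c < K \<Longrightarrow> \<exists>u\<in>N x. p u = c"
  using edge_minimal_matched[of p x c] by (auto simp: part_def)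

lemma edge_minimal_moved: "edge_minimal p \<Longrightarrow> c \<in> absent p v \<Longrightarrow> edge_minimal (p(v := c))"
  by (rule edge_minimal_upd) (auto simp: absent_def)

lemma poorD: "poor p v \<Longrightarrow> N v \<noteq> {}" "poor p v \<Longrightarrow> mates p v = {}" "poor p v \<Longrightarrow> balanced p v"
  by (simp_all add: poor_def)

lemma poor_V: "poor p v \<Longrightarrow> v \<in> V"
  using poorD(1)[of p v] N_V(2) by blast

text \<open>If two vertices of \<open>A v\<close> were both alone there in their classes, poorness
  would put them into the same class.\<close>

lemma poor_pair:
  assumes "poor p v" "near_proper p"
  obtains m where "card {u \<in> A v. p u = m} = 2"
proof -
  have "2 \<le> card (A v)" using assms balanced_A2[of p v] by (simp add: poorD near_proper_def)
  then obtain x y where xy: "x \<in> A v" "y \<in> A v" "x \<noteq> y"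
    using card_2_iff[of "A v"] by (metis card_le_Suc0_iff_eq finN(2) not_less_eq_eq numeral_2_eq_2)
  let ?f = "\<lambda>c. card {u \<in> A v. p u = c}"
  have pos: "1 \<le> ?f (p u)" if "u \<in> A v" for u
  proof -
    have "{w \<in> A v. p w = p u} \<noteq> {}" using that by blast
    then have "?f (p u) \<noteq> 0" by simp
    then show ?thesis by linarith
  qed
  have "?f (p x) = 2 \<or> ?f (p y) = 2"
  proof (rule ccontr)
    assume no: "\<not> ?thesis"
    have "?f (p x) = 1" "?f (p y) = 1"
      using no pos[OF xy(1)] pos[OF xy(2)] near_proper_cl2[OF assms(2), of v "p x"] near_proper_cl2[OF assms(2), of v "p y"]
      by linarith+
    then have e: "p x = p y" by (rule poor_single[OF assms(1)])
    have "{x, y} \<subseteq> {u \<in> A v. p u = p x}" using xy e by auto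
    then have "card {x, y} \<le> ?f (p x)" by (intro card_mono) auto
    then show False using \<open>?f (p x) = 1\<close> xy(3) by simp
  qed
  then show ?thesis using that by blast
qed

text \<open>Each value other than 1 is at least 2, so the sum falls short of \<open>2 * k\<close> by
  at most the number of ones.\<close>

lemma many_ones:
  fixes f :: "nat \<Rightarrow> nat"
  assumes "\<And>c. c < k \<Longrightarrow> 1 \<le> f c" "(\<Sum>c<k. f c) + l \<le> 2 * k"
  shows "l \<le> card {c. c < k \<and> f c = 1}"
proof -
  have "(\<Sum>c<k. 2) \<le> (\<Sum>c<k. f c + (if f c = 1 then 1 else 0))"
  proof (rule sum_mono)
    fix c assume "c \<in> {..<k}"
    then show "2 \<le> f c + (if f c = 1 then 1 else 0)" using assms(1)[of c] by auto
  qed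
  also have "\<dots> = (\<Sum>c<k. f c) + card {c \<in> {..<k}. f c = 1}"
    by (simp add: sum.distrib sum.inter_filter[symmetric])
  finally show ?thesis using assms(2) by simp
qed

lemma in_absent: "c \<in> absent p v \<longleftrightarrow> c < K \<and> (\<forall>u\<in>N v. p u \<noteq> c)"
  by (auto simp: absent_def part_def)

lemma ex_diff: "card X \<le> n \<Longrightarrow> n < card Y \<Longrightarrow> finite X \<Longrightarrow> \<exists>y\<in>Y. y \<notin> X"
proof (rule ccontr)
  assume a: "card X \<le> n" "n < card Y" "finite X" "\<not> (\<exists>y\<in>Y. y \<notin> X)"
  then have "card Y \<le> card X" by (intro card_mono) auto
  then show False using a by simp
qed

lemma ex_diff2: "3 \<le> card Y \<Longrightarrow> \<exists>y\<in>Y. y \<noteq> a \<and> y \<noteq> b"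
proof -
  have "card {a, b} \<le> 2" by (rule order.trans[OF card_insert_le_m1]) auto
  then show "3 \<le> card Y \<Longrightarrow> ?thesis" using ex_diff[of "{a, b}" 2 Y] by simp
qed

text \<open>
  Moving \<open>x\<close> to a class in which it has a single neighbor (after \<open>v\<close> has left that class, if need
  be) makes \<open>v\<close> no longer poor, so some vertex \<open>z\<close> becomes poor. By the choice of \<open>x\<close> over \<open>x'\<close>
  expressed in the last assumption, \<open>z\<close> lies in the clique of \<open>N x\<close> that does not contain \<open>v\<close>. As
  \<open>x\<close> has at least three such classes, there are three such vertices; two of them are solo neighbors
  of the third, which forces them into the same class.
\<close>

lemma poor_core:
  assumes em: "edge_minimal p"
    and mini: "\<And>q. edge_minimal q \<Longrightarrow> card {u \<in> V. poor p u} \<le> card {u \<in> V. poor q u}"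
    and pv: "poor p v" and xA: "{u \<in> A v. p u = m} = {x, x'}" and nx: "x \<noteq> x'"
    and ori: "\<And>z. z \<in> B v \<Longrightarrow> mates p z = {} \<Longrightarrow> z \<in> N x \<Longrightarrow> z \<in> N x'"
  shows False
proof -
  define i where "i = p v"
  have bv: "balanced p v" and sv: "mates p v = {}" using poorD[OF pv] by auto
  have near: "near_proper p" and cp: "in_range p" using em by (simp_all add: edge_minimal_near_proper edge_minimal_in_range)
  have xx: "x \<in> A v" "x' \<in> A v" "p x = m" "p x' = m" using xA by auto
  then have xN: "x \<in> N v" "x' \<in> N v" "v \<in> N x" "v \<in> N x'" using A_nbr nbr_sym by blast+
  have xx': "x' \<in> N x" "x \<in> N x'" using clA[OF xx(1,2) nx] nbr_sym by blast+
  have vx: "v \<noteq> x" "v \<noteq> x'" using xN nbr_neq by blast+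
  have xB: "x \<notin> B v" "x' \<notin> B v" using xx disj[of v] by auto
  have mK: "m < K" using cp xx(3) N_V(1)[OF xN(1)] by (auto simp: in_range_def)
  have iK: "i < K" using cp N_V(2)[OF xN(1)] by (auto simp: in_range_def i_def)
  have ownx: "mates p x = {x'}" "mates p x' = {x}"
  proof -
    have "x' \<in> mates p x" "x \<in> mates p x'" using xx xx' by (auto simp: in_mates)
    moreover have "card (mates p x) \<le> 1" "card (mates p x') \<le> 1" using near by (auto simp: near_proper_def)
    ultimately show "mates p x = {x'}" "mates p x' = {x}"
      by (auto simp: card_le_Suc0_iff_eq)
  qed
  have mz: "t \<noteq> m" if "t \<in> absent p v" for t using that xN(1) xx(3) by (auto simp: in_absent)
  have iz: "i \<in> absent p v" using sv iK by (auto simp: in_absent in_mates i_def)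
  have ptv: "u \<in> N v \<Longrightarrow> p u \<noteq> i" for u using iz by (auto simp: in_absent)
  have z3: "3 \<le> card (absent p v)" by (rule poor_absent3[OF pv near])
  have em1: "edge_minimal (p(v := t))" if "t \<in> absent p v" for t
    by (rule edge_minimal_moved[OF em that])
  \<comment> \<open>\<open>v\<close> is not counted because it may be moved away before
    \<open>x\<close> enters its class.\<close>
  define d where "d c = card (part p x c - {v})" for c
  have d1: "1 \<le> d c" if c: "c < K" for c
  proof -
    have "part p x c - {v} \<noteq> {}"
    proof (cases "c = i")
      case False
      then show ?thesis using edge_minimal_matched[OF em _ c, of x] ownx by (auto simp: in_part i_def)
    next
      case True
      \<comment> \<open>In class \<open>i\<close> the vertex \<open>v\<close> itself might be the
        only neighbor, so it is first moved to another absent class. The mate of \<open>x\<close> is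
        unaffected, and edge-minimality applies to the new partition.\<close>
      obtain t where t: "t \<in> absent p v" "t \<noteq> i" using ex_diff2[OF z3, of i i] by blast
      have "x' \<in> mates (p(v := t)) x" using xx xx' vx by (auto simp: in_mates)
      then have "part (p(v := t)) x c \<noteq> {}" using edge_minimal_matched[OF em1[OF t(1)] _ c, of x] by blast
      moreover have "part (p(v := t)) x c \<subseteq> part p x c - {v}" using t(2) True by (auto simp: in_part split: if_splits)
      ultimately show ?thesis by blast
    qed
    then have "d c \<noteq> 0" unfolding d_def by simp
    then show ?thesis by linarith
  qed
  have "(\<Sum>c<K. d c) + 1 = card (N x)"
  proof -
    have "(\<Sum>c<K. card (part p x c)) = (\<Sum>c<K. d c + (if c = i then 1 else 0))"
    proof (rule sum.cong)
      fix c
      show "card (part p x c) = d c + (if c = i then 1 else 0)"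
      proof (cases "c = i")
        case True
        then have "v \<in> part p x c" using xN by (simp add: in_part i_def)
        then show ?thesis using True card.remove[of "part p x c" v] by (simp add: d_def)
      next
        case False
        then have "part p x c - {v} = part p x c" by (auto simp: in_part i_def)
        then show ?thesis using False by (simp add: d_def)
      qed
    qed simp
    also have "\<dots> = (\<Sum>c<K. d c) + 1" using iK by (simp add: sum.distrib)
    finally show ?thesis using sum_part[OF cp, of x] by simp
  qed
  \<comment> \<open>Leaving out \<open>v\<close> and the slack in \<open>K\<close> yield four
    classes with \<open>d c = 1\<close>. One of them may be \<open>m\<close>, the class of
    \<open>x\<close>, which leaves three in \<open>Ones\<close>.\<close>
  then have "(\<Sum>c<K. d c) + 4 \<le> 2 * K" using deg[of x] D_lt by linarith
  then have c4: "4 \<le> card {c. c < K \<and> d c = 1}" using d1 by (intro many_ones) auto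
  define Ones where "Ones = {c. c < K \<and> d c = 1} - {m}"
  have c3: "3 \<le> card Ones"
    using c4 diff_card_le_card_Diff[of "{m}" "{c. c < K \<and> d c = 1}"] by (simp add: Ones_def)
  define Q where "Q c t = p(v := t, x := c)" for c t
  have step: "\<exists>t z. t \<in> absent p v \<and> t \<noteq> c \<and> edge_minimal (Q c t) \<and> poor (Q c t) z \<and> z \<in> N x \<and> z \<notin> N v \<and> z \<noteq> v"
    if c: "c \<in> Ones" for c
  proof -
    have cK: "c < K" and cm: "c \<noteq> m" and dc: "d c = 1" using c by (auto simp: Ones_def)
    \<comment> \<open>\<open>v\<close> stays in place unless \<open>x\<close> moves to its class. In
      that case \<open>v\<close> has at least two other absent classes to go to, and they cannot
      both make vertices of \<open>B v\<close> outside \<open>N x\<close> newly poor.\<close>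
    have "\<exists>t. t \<in> absent p v \<and> t \<noteq> c \<and> (c \<noteq> i \<longrightarrow> t = i) \<and> (\<forall>z\<in>B v. z \<notin> N x \<longrightarrow> poor (Q c t) z \<longrightarrow> poor p z)"
    proof (cases "c = i")
      case False
      have "poor p z" if "z \<in> B v" "z \<notin> N x" "poor (Q c i) z" for z
      proof -
        have "x \<notin> N z" using that nbr_sym by blast
        moreover have "z \<noteq> x" using that xB by blast
        ultimately show ?thesis by (intro poor_cong_imp[OF that(3)]) (auto simp: Q_def i_def)
      qed
      then show ?thesis using iz False by blast
    next
      case ci: True
      obtain t where t: "t \<in> absent p v" "t \<noteq> i" using ex_diff2[OF z3, of i i] by blast
      obtain t' where t': "t' \<in> absent p v" "t' \<noteq> i" "t' \<noteq> t"
        using ex_diff2[OF z3, of i t] by blast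
      show ?thesis
      proof (rule ccontr)
        assume no: "\<not> ?thesis"
        then obtain z where z: "z \<in> B v" "z \<notin> N x" "poor (Q c t) z" using t ci by blast
        from no obtain z' where z': "z' \<in> B v" "z' \<notin> N x" "poor (Q c t') z'" using t' ci by blast
        have solo: "mates p y = {}" if y: "y \<in> B v" "y \<notin> N x" "poor (Q c s) y" for y s
        proof -
          have n: "x \<notin> N y" "y \<noteq> x" "y \<in> N v" "y \<noteq> v" using y nbr_sym xB B_nbr nbr_neq by blast+
          have "p u \<noteq> p y" if u: "u \<in> N y" for u
          proof -
            have "Q c s u \<noteq> Q c s y" using poorD(2)[OF y(3)] u by (simp add: mates_empty)
            moreover have "u \<noteq> x" using u n by blast
            ultimately show ?thesis using ptv[OF n(3)] n by (cases "u = v") (simp_all add: Q_def i_def)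
          qed
          then show ?thesis by (simp add: mates_empty)
        qed
        have zz: "z = z'"
        proof (rule ccontr)
          assume ne: "z \<noteq> z'"
          have "p z = p z'" by (rule poor_solos[OF pv B_nbr[OF z(1)] solo[OF z] B_nbr[OF z'(1)] solo[OF z']])
          moreover have "z' \<in> N z" using clB[OF z(1) z'(1) ne] .
          ultimately show False using solo_adj[OF solo[OF z], of z'] by blast
        qed
        have xz: "x \<notin> N z" "v \<in> N z" using z nbr_sym B_nbr by blast+
        \<comment> \<open>Sending \<open>v\<close> to \<open>t\<close> instead of \<open>t'\<close>
          changes the number of neighbors of \<open>z\<close> in class \<open>t\<close> by one, but
          balance makes it even both times.\<close>
        have "part (Q c t) z t = insert v (part (Q c t') z t)"
          using xz t(2) t'(3) vx by (auto simp: in_part Q_def split: if_splits)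
        moreover have "v \<notin> part (Q c t') z t" using t'(3) vx by (auto simp: in_part Q_def)
        ultimately have "card (part (Q c t) z t) = Suc (card (part (Q c t') z t))" by simp
        moreover have "even (card (part (Q c t) z t))" "even (card (part (Q c t') z t))"
          using balanced_even poorD(3) z(3) z'(3) zz by blast+
        ultimately show False by simp
      qed
    qed
    then obtain t where t: "t \<in> absent p v" "t \<noteq> c" "c \<noteq> i \<longrightarrow> t = i"
      and tB: "\<And>z. z \<in> B v \<Longrightarrow> z \<notin> N x \<Longrightarrow> poor (Q c t) z \<Longrightarrow> poor p z" by blast
    define p1 where "p1 = p(v := t)"
    have Qp: "Q c t = p1(x := c)" by (simp add: Q_def p1_def)
    have e1: "edge_minimal p1" using em1[OF t(1)] by (simp add: p1_def)
    have o1: "x' \<in> mates p1 x" "x \<in> mates p1 x'" using xx xx' vx by (auto simp: in_mates p1_def)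
    then have o1c: "1 \<le> card (mates p1 x)" by (metis One_nat_def Suc_leI card_gt_0_iff empty_iff finN(5))
    have "part p1 x c = part p x c - {v}" using t(2) by (auto simp: in_part p1_def split: if_splits)
    then have cp1: "card (part p1 x c) = 1" using dc by (simp add: d_def)
    have eQ: "edge_minimal (Q c t)" unfolding Qp by (rule edge_minimal_upd[OF e1 cK]) (use cp1 o1c in simp)
    have tm: "t \<noteq> m" using mz t by blast
    \<comment> \<open>\<open>x\<close> has left class \<open>m\<close>, which now meets
      \<open>A v\<close> once but still meets \<open>B v\<close> twice.\<close>
    have nv: "\<not> poor (Q c t) v"
    proof
      assume "poor (Q c t) v"
      then have "balanced (Q c t) v" by (rule poorD)
      then have "card {u \<in> A v. Q c t u = m} = card {u \<in> B v. Q c t u = m}" by (simp add: balanced_def)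
      moreover have "{u \<in> A v. Q c t u = m} = {x'}"
        using xA xx nx vx cm tm by (auto simp: Q_def split: if_splits)
      moreover have "{u \<in> B v. Q c t u = m} = {u \<in> B v. p u = m}"
        using xB irr[of v] B_nbr[of v v] by (auto simp: Q_def)
      moreover have "card {u \<in> B v. p u = m} = 2" using balancedD[OF bv, of m] xA nx by simp
      ultimately show False by simp
    qed
    \<comment> \<open>\<open>x'\<close> saw all classes while it had a mate. The departure of
      \<open>x\<close> can make only class \<open>m\<close> absent, while balance requires two
      absent classes.\<close>
    have nx': "\<not> poor (Q c t) x'"
    proof
      assume "poor (Q c t) x'"
      then have "2 \<le> card (absent (Q c t) x')" using balanced_absent2 poorD(3) edge_minimal_in_range[OF eQ] by blast
      moreover have "absent (Q c t) x' \<subseteq> {m}"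
      proof
        fix e assume e: "e \<in> absent (Q c t) x'"
        then obtain u where "u \<in> N x'" "p1 u = e"
          using edge_minimal_sees[OF e1 o1(2), of e] by (auto simp: in_absent)
        moreover from this have "u = x" using e by (auto simp: in_absent Qp split: if_splits)
        ultimately show "e \<in> {m}" using xx vx by (simp add: p1_def)
      qed
      then have "card (absent (Q c t) x') \<le> 1" using card_mono[of "{m}"] by fastforce
      ultimately show False by simp
    qed
    have nxx: "\<not> poor (Q c t) x"
      using poorD(2)[of "Q c t" x] mates_upd_self[of p1 x c] cp1 unfolding Qp by auto
    obtain z where z: "poor (Q c t) z" "\<not> poor p z"
    proof (rule ccontr)
      assume "\<not> thesis"
      then have "\<And>z. poor (Q c t) z \<Longrightarrow> poor p z" using that by blast
      then have "{u \<in> V. poor (Q c t) u} \<subset> {u \<in> V. poor p u}" using nv pv poor_V[OF pv] by blast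
      then have "card {u \<in> V. poor (Q c t) u} < card {u \<in> V. poor p u}" using fin by (intro psubset_card_mono) auto
      then show False using mini[OF eQ] by simp
    qed
    have zn: "z \<noteq> x" "z \<noteq> x'" "z \<noteq> v" using z nv nx' nxx by blast+
    have zq: "Q c t z = p z" using zn by (simp add: Q_def)
    have znv: "z \<notin> N v"
    proof
      assume zv: "z \<in> N v"
      then have vz: "v \<in> N z" using nbr_sym by blast
      show False
      proof (cases "z \<in> N x'")
        case True
        \<comment> \<open>After the moves both \<open>v\<close> and \<open>x'\<close> are solo, but
          in the different classes \<open>t\<close> and \<open>m\<close>, so they cannot both be
          neighbors of a poor \<open>z\<close>.\<close>
        have "mates (Q c t) v = {}"
        proof -
          have "part p v t = {}" using t(1) by (simp add: absent_def)
          then show ?thesis using t(2) vx irr[of v] by (auto simp: in_mates in_part Q_def set_eq_iff split: if_splits)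
        qed
        moreover have "mates (Q c t) x' = {}"
        proof (rule ccontr)
          assume "mates (Q c t) x' \<noteq> {}"
          then obtain u where u: "u \<in> N x'" "Q c t u = m" using vx nx xx by (auto simp: in_mates Q_def)
          then have "u \<noteq> x" "u \<noteq> v" using cm tm vx by (auto simp: Q_def)
          then have "u \<in> mates p x'" using u xx by (simp add: in_mates Q_def)
          then show False using ownx \<open>u \<noteq> x\<close> by simp
        qed
        moreover have "x' \<in> N z" using True nbr_sym by blast
        ultimately have "Q c t v = Q c t x'" using poor_solos[OF z(1) vz] by blast
        then show False using vx nx xx tm by (simp add: Q_def)
      next
        case False
        then have "z \<notin> A v" using clA[OF xx(2), of z] zn by blast
        then have zB: "z \<in> B v" using zv N_eq[of v] by blast
        show False
        proof (cases "z \<in> N x")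
          case True
          have pm: "p z \<noteq> m"
          proof
            assume "p z = m"
            then have "z \<in> mates p x" using True xx by (simp add: in_mates)
            then show False using ownx zn by simp
          qed
          have "mates p z = {}"
          proof (rule ccontr)
            assume "mates p z \<noteq> {}"
            then obtain u where u: "u \<in> N z" "p u = p z" by (auto simp: in_mates)
            have "u \<noteq> v" using ptv[OF zv] u by (auto simp: i_def)
            moreover have "u \<noteq> x" using u pm xx by auto
            ultimately have "u \<in> mates (Q c t) z" using u zq by (simp add: in_mates Q_def)
            then show False using poorD(2)[OF z(1)] by simp
          qed
          then show False using ori[OF zB _ True] False by blast
        next
          case False
          then show False using tB[OF zB _ z(1)] z(2) by blast
        qed
      qed
    qed
    have "z \<in> N x"
    proof (rule ccontr)
      assume "z \<notin> N x"
      then have "x \<notin> N z" "v \<notin> N z" using znv nbr_sym by blast+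
      then have "poor (Q c t) z \<longleftrightarrow> poor p z" using zn by (intro poor_cong) (auto simp: Q_def)
      then show False using z by blast
    qed
    then show ?thesis using t eQ z znv zn by blast
  qed
  then obtain tt zz where T: "\<And>c. c \<in> Ones \<Longrightarrow> tt c \<in> absent p v \<and> tt c \<noteq> c \<and> edge_minimal (Q c (tt c)) \<and>
      poor (Q c (tt c)) (zz c) \<and> zz c \<in> N x \<and> zz c \<notin> N v \<and> zz c \<noteq> v" by metis
  have Ones_D: "c < K" "c \<noteq> m" "d c = 1" if "c \<in> Ones" for c using that by (auto simp: Ones_def)
  have zxx: "zz c \<noteq> x" "x \<in> N (zz c)" "v \<notin> N (zz c)" "zz c \<noteq> x'" if "c \<in> Ones" for c
    using T[OF that] nbr_sym nbr_neq xN(2) by blast+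
  \<comment> \<open>No \<open>zz e\<close> is adjacent to \<open>v\<close>, so \<open>x\<close> is
    the only moved vertex in its neighborhood.\<close>
  have agr: "Q c (tt c) u = p u" if "c \<in> Ones" "e \<in> Ones" "u \<in> N (zz e)" "u \<noteq> x" for c e u
  proof -
    have "u \<noteq> v" using that(3) zxx(3)[OF that(2)] by blast
    then show ?thesis using that by (simp add: Q_def)
  qed
  have Qx: "Q c t x = c" for c t by (simp add: Q_def)
  have Qz: "Q c t (zz e) = p (zz e)" if "e \<in> Ones" for c t e
    using zxx[OF that] T[OF that] by (simp add: Q_def)
  have pzm: "p (zz c) \<noteq> m" if c: "c \<in> Ones" for c
  proof
    assume "p (zz c) = m"
    then have "zz c \<in> mates p x" using T[OF c] xx by (simp add: in_mates)
    then show False using ownx zxx[OF c] by simp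
  qed
  have solo: "mates p (zz c) = {}" if c: "c \<in> Ones" for c
  proof (rule ccontr)
    assume "mates p (zz c) \<noteq> {}"
    then obtain u where u: "u \<in> N (zz c)" "p u = p (zz c)" by (auto simp: in_mates)
    then have "u \<noteq> x" using pzm[OF c] xx by auto
    then have "u \<in> mates (Q c (tt c)) (zz c)" using u agr[OF c c u(1)] Qz[OF c] by (simp add: in_mates)
    then show False using poorD(2) T[OF c] by blast
  qed
  \<comment> \<open>Parity tells the new poor vertices apart: among the classes in
    \<open>Ones\<close>, only \<open>c\<close> holds an odd number of neighbors of
    \<open>zz c\<close> before \<open>x\<close> arrives.\<close>
  have par: "odd (card (part p (zz c) c))" if c: "c \<in> Ones" for c
  proof -
    have "part (Q c (tt c)) (zz c) c = insert x (part p (zz c) c)"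
      using zxx[OF c] agr[OF c c] Qx by (fastforce simp: in_part)
    moreover have "x \<notin> part p (zz c) c" using xx Ones_D[OF c] by (auto simp: in_part)
    moreover have "even (card (part (Q c (tt c)) (zz c) c))" using balanced_even poorD(3) T[OF c] by blast
    ultimately show ?thesis by simp
  qed
  have par': "even (card (part p (zz c) e))" if c: "c \<in> Ones" and e: "e \<in> Ones" "e \<noteq> c" for c e
  proof -
    have "part (Q c (tt c)) (zz c) e = part p (zz c) e"
      using agr[OF c c] Qx e Ones_D[OF e(1)] xx by (auto simp: in_part) (metis+)
    moreover have "even (card (part (Q c (tt c)) (zz c) e))" using balanced_even poorD(3) T[OF c] by blast
    ultimately show ?thesis by simp
  qed
  have dist: "zz c \<noteq> zz e" if "c \<in> Ones" "e \<in> Ones" "c \<noteq> e" for c e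
    using par[OF that(2)] par'[OF that(1,2)] that(3) by metis
  have inos: "zz c \<in> opp x v" if c: "c \<in> Ones" for c
  proof -
    have "zz c \<notin> side x v" using side_cl[OF side_in[OF xN(3)], of "zz c"] T[OF c] by blast
    then show ?thesis using side_opp(1)[of x v] T[OF c] by blast
  qed
  have adj: "zz e \<in> N (zz c)" if "c \<in> Ones" "e \<in> Ones" "c \<noteq> e" for c e
    by (rule opp_cl[OF inos inos dist]) fact+
  \<comment> \<open>If \<open>zz e\<close> were in class \<open>c\<close>, it would be the one
    neighbor of \<open>x\<close> counted by \<open>d c\<close>. Moving it, and \<open>v\<close> if
    necessary, out of class \<open>c\<close> keeps edge-minimality, so \<open>x\<close> must see a
    further vertex of this class.\<close>
  have mv: "p (zz e) \<noteq> c" if c: "c \<in> Ones" and e: "e \<in> Ones" and ne: "c \<noteq> e" for c e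
  proof
    assume pc: "p (zz e) = c"
    have "3 \<le> card (absent (Q e (tt e)) (zz e))" using poor_absent3 edge_minimal_near_proper T[OF e] by blast
    then obtain t where t: "t \<in> absent (Q e (tt e)) (zz e)" "t \<notin> {c, m}"
      using ex_diff2[of "absent (Q e (tt e)) (zz e)" c m] by blast
    \<comment> \<open>In the partition from which \<open>t\<close> is taken, \<open>x\<close> is no
      longer in class \<open>m\<close>; this is why \<open>t\<close> was chosen different from
      \<open>m\<close>.\<close>
    have tz: "t \<in> absent p (zz e)"
      unfolding in_absent
    proof (intro conjI ballI)
      show "t < K" using t by (simp add: in_absent)
      fix u assume u: "u \<in> N (zz e)"
      show "p u \<noteq> t"
      proof (cases "u = x")
        case True then show ?thesis using t xx by auto
      next
        case False
        then show ?thesis using agr[OF e e u] t u by (auto simp: in_absent)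
      qed
    qed
    define p1 where "p1 = p(v := tt c)"
    have e1: "edge_minimal p1" using em1 T[OF c] by (simp add: p1_def)
    have "t \<in> absent p1 (zz e)" using tz zxx[OF e] by (auto simp: in_absent p1_def)
    then have e2: "edge_minimal (p1(zz e := t))" by (rule edge_minimal_moved[OF e1])
    have "x' \<in> mates (p1(zz e := t)) x" using xx xx' vx zxx[OF e] by (auto simp: in_mates p1_def)
    then obtain u where u: "u \<in> N x" "(p1(zz e := t)) u = c"
      using edge_minimal_sees[OF e2 _ Ones_D(1)[OF c]] by blast
    then have "u \<noteq> zz e" "u \<noteq> v" using t T[OF c] T[OF e] by (auto simp: p1_def)
    then have "{u, zz e} \<subseteq> part p x c - {v}" using u pc T[OF e] by (auto simp: in_part p1_def)
    then have "card {u, zz e} \<le> d c" unfolding d_def by (intro card_mono) auto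
    then show False using Ones_D(3)[OF c] \<open>u \<noteq> zz e\<close> by simp
  qed
  obtain S where "S \<subseteq> Ones" "card S = 3" using c3 by (meson obtain_subset_with_card_n)
  then obtain c1 c2 c3 where C: "c1 \<in> Ones" "c2 \<in> Ones" "c3 \<in> Ones" "c1 \<noteq> c2" "c2 \<noteq> c3" "c1 \<noteq> c3"
    by (auto simp: card_3_iff)
  have sq: "mates (Q c1 (tt c1)) (zz e) = {}" if e: "e \<in> Ones" "c1 \<noteq> e" for e
  proof (rule ccontr)
    assume "mates (Q c1 (tt c1)) (zz e) \<noteq> {}"
    then obtain u where u: "u \<in> N (zz e)" "Q c1 (tt c1) u = p (zz e)" using Qz[OF e(1)] by (auto simp: in_mates)
    have "u \<noteq> x" using u mv[OF C(1) e] Qx by auto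
    then have "u \<in> mates p (zz e)" using u agr[OF C(1) e(1) u(1)] by (simp add: in_mates)
    then show False using solo[OF e(1)] by simp
  qed
  \<comment> \<open>By \<open>mv\<close>, \<open>zz c2\<close> and \<open>zz c3\<close> stay solo
    when \<open>x\<close> moves to class \<open>c1\<close>. As neighbors of the poor vertex
    \<open>zz c1\<close> they share a class, although they are adjacent.\<close>
  have "Q c1 (tt c1) (zz c2) = Q c1 (tt c1) (zz c3)"
    by (rule poor_solos[OF _ adj[OF C(1,2,4)] sq[OF C(2,4)] adj[OF C(1,3,6)] sq[OF C(3,6)]]) (use T[OF C(1)] in blast)
  then have "p (zz c2) = p (zz c3)" using Qz C by simp
  then show False using solo_adj[OF solo[OF C(2)] adj[OF C(2,3,5)]] by blast
qed

text \<open>Applying \<open>poor_core\<close> to both orders of \<open>x\<close> and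
  \<open>x'\<close> yields two solo vertices of \<open>B v\<close>, each adjacent to exactly one of
  \<open>x\<close> and \<open>x'\<close> and not to the same one. They are therefore distinct, hence
  adjacent, yet poorness of \<open>v\<close> puts them into one class.\<close>

lemma edge_minimal_no_poor:
  assumes em: "edge_minimal p"
    and mini: "\<And>q. edge_minimal q \<Longrightarrow> card {u \<in> V. poor p u} \<le> card {u \<in> V. poor q u}"
  shows "\<not> poor p v"
proof
  assume pv: "poor p v"
  obtain m where "card {u \<in> A v. p u = m} = 2" by (rule poor_pair[OF pv edge_minimal_near_proper[OF em]])
  then obtain x x' where xx: "{u \<in> A v. p u = m} = {x, x'}" "x \<noteq> x'" by (auto simp: card_2_iff)
  have "\<exists>z. z \<in> B v \<and> mates p z = {} \<and> z \<in> N x \<and> z \<notin> N x'"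
    using poor_core[OF em mini pv xx] by blast
  then obtain z where z: "z \<in> B v" "mates p z = {}" "z \<in> N x" "z \<notin> N x'" by blast
  have "\<exists>z. z \<in> B v \<and> mates p z = {} \<and> z \<in> N x' \<and> z \<notin> N x"
    using poor_core[OF em mini pv, of m x' x] xx by blast
  then obtain z' where z': "z' \<in> B v" "mates p z' = {}" "z' \<in> N x'" "z' \<notin> N x" by blast
  have "z' \<in> N z" using clB[OF z(1) z'(1)] z z' by blast
  then show False
    using solo_adj[OF z(2)] poor_solos[OF pv B_nbr[OF z(1)] z(2) B_nbr[OF z'(1)] z'(2)] by blast
qed

lemma ex_no_poor: "\<exists>p. near_proper p \<and> (\<forall>v. \<not> poor p v)"
proof -
  have "\<exists>p. in_range p" using D_lt(2) by (intro exI[of _ "\<lambda>_. 0"]) (simp add: in_range_def)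
  then obtain p0 where "in_range p0" "\<And>q. in_range q \<Longrightarrow> card (mono_pairs p0) \<le> card (mono_pairs q)"
    using ex_has_least_nat[of in_range _ "\<lambda>p. card (mono_pairs p)"] by blast
  then have "edge_minimal p0" by (simp add: edge_minimal_def)
  then obtain p where p: "edge_minimal p" "\<And>q. edge_minimal q \<Longrightarrow> card {u \<in> V. poor p u} \<le> card {u \<in> V. poor q u}"
    using ex_has_least_nat[of edge_minimal _ "\<lambda>p. card {u \<in> V. poor p u}"] by blast
  show ?thesis using edge_minimal_near_proper[OF p(1)] edge_minimal_no_poor[OF p] by blast
qed

section \<open>Solo vertices leaving or entering a class around a balanced vertex\<close>

lemma side_N: "u \<in> side v w \<Longrightarrow> u \<in> N v" and opp_N: "u \<in> opp v w \<Longrightarrow> u \<in> N v"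
  using side_opp(1)[of v w] by auto

lemma balanced_side_empty:
  assumes "balanced p v" "{u \<in> side v w. p u = c} = {}" shows "{u \<in> opp v w. p u = c} = {}"
proof -
  have "card {u \<in> opp v w. p u = c} = 0"
    using balanced_side[OF assms(1), of w c] by (simp only: assms(2) card.empty)
  then show ?thesis by (simp only: card_eq_0_iff) simp
qed

text \<open>In its own clique of \<open>N y\<close>, \<open>z\<close> was alone in its class, so
  after the move that clique misses the class. By balance the opposite clique misses it too, and
  nothing in the opposite clique has left or entered this class.\<close>

lemma left_class:
  assumes "balanced q y" "z \<in> N y" "mates p z = {}" "q z \<noteq> p z"
    and agr: "\<And>u. u \<in> N y \<Longrightarrow> u \<noteq> z \<Longrightarrow> q u = p z \<longleftrightarrow> p u = p z"
  shows "part p y (p z) = {z}"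
proof -
  have zs: "z \<in> side y z" using side_in assms(2) .
  have no: "z \<notin> opp y z" using zs side_opp(2)[of y z] by blast
  have "u \<notin> side y z" if "u \<noteq> z" "p u = p z" for u
    using solo_side[OF assms(3,2)] that by blast
  then have "q u \<noteq> p z" if "u \<in> side y z" for u
    using that agr[OF side_N[OF that]] assms(4) by (cases "u = z") auto
  then have "{u \<in> side y z. q u = p z} = {}" by blast
  then have "{u \<in> opp y z. q u = p z} = {}" by (rule balanced_side_empty[OF assms(1)])
  moreover have "q u = p z \<longleftrightarrow> p u = p z" if "u \<in> opp y z" for u
    using agr[OF opp_N[OF that]] no that by blast
  ultimately have "{u \<in> opp y z. p u = p z} = {}" by blast
  then show ?thesis unfolding part_side(1)[of p y "p z" z] solo_side[OF assms(3,2)] by blast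
qed

text \<open>\<open>z\<close> is alone with its class in its clique, so balance gives exactly one
  partner \<open>t\<close> in the other clique. By poorness no other class meets \<open>A y\<close>
  in a single vertex, so by \<open>solo_single\<close> all solo neighbors belong to this
  class.\<close>

lemma arrival:
  assumes "poor q y" "z \<in> N y" "mates q z \<inter> N y = {}"
  shows "\<exists>t. t \<noteq> z \<and> part q y (q z) = {z, t} \<and> (\<forall>u\<in>N y. mates q u = {} \<longrightarrow> u \<in> {z, t})"
proof -
  have b: "balanced q y" using poorD(3) assms(1) .
  have zs: "z \<in> side y z" using side_in assms(2) .
  have "u = z" if "u \<in> side y z" "q u = q z" for u
    using side_cl[OF zs that(1)] that assms(3) side_N[OF that(1)] by (auto simp: in_mates)
  then have s: "{u \<in> side y z. q u = q z} = {z}" using zs by blast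
  then have o: "card {u \<in> opp y z. q u = q z} = 1" using balanced_side[OF b, of z "q z"] by simp
  then obtain t where t: "{u \<in> opp y z. q u = q z} = {t}" by (auto simp: card_1_singleton_iff)
  have "t \<noteq> z" using t zs side_opp(2)[of y z] by blast
  moreover have pq: "part q y (q z) = {z, t}" unfolding part_side(1)[of q y "q z" z] s t by auto
  moreover have "u \<in> {z, t}" if u: "u \<in> N y" "mates q u = {}" for u
  proof -
    have "card {x \<in> A y. q x = q z} = 1" using balancedD[OF b, of "q z"] s o by (auto simp: side_def opp_def split: if_splits)
    then have "q u = q z" by (rule poor_single[OF assms(1) solo_single[OF b u]])
    then have "u \<in> part q y (q z)" using u(1) by (simp add: in_part)
    then show ?thesis by (simp only: pq)
  qed
  ultimately show ?thesis by blast
qed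

lemma odd_not_balanced: "odd (card (part q y c)) \<Longrightarrow> \<not> balanced q y"
  using balanced_even by blast

definition matched :: "('a \<Rightarrow> nat) \<Rightarrow> 'a set" where
  "matched p = {v \<in> V. mates p v \<noteq> {}}"

definition balanced_solos :: "('a \<Rightarrow> nat) \<Rightarrow> 'a set" where
  "balanced_solos p = {w. N w \<noteq> {} \<and> mates p w = {} \<and> balanced p w}"

end

section \<open>Independence of the balanced vertices\<close>

locale optimal_classes = clique_cover +
  fixes p :: "'a \<Rightarrow> nat"
  assumes near: "near_proper p"
    and not_poor: "\<not> poor p v"
    and max_matched: "near_proper q \<Longrightarrow> (\<And>v. \<not> poor q v) \<Longrightarrow> card (matched q) \<le> card (matched p)"
begin

lemma pK: "v \<in> V \<Longrightarrow> p v < K"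
  using near by (simp add: near_proper_def in_range_def)

text \<open>A move that only creates a new pair of mates contradicts maximality unless it creates a poor vertex.\<close>

lemma new_poor:
  assumes c: "in_range q" and e: "a \<in> N b" "mates p a = {}" "mates p b = {}" "mates q a = {b}" "mates q b = {a}"
    and oth: "\<And>y. y \<noteq> a \<Longrightarrow> y \<noteq> b \<Longrightarrow> mates q y = mates p y"
  shows "\<exists>y. poor q y \<and> mates p y = {} \<and> y \<noteq> a \<and> y \<noteq> b"
proof -
  have "card (mates q y) \<le> 1" for y
    using near e oth[of y] by (cases "y = a"; cases "y = b") (auto simp: near_proper_def)
  then have vq: "near_proper q" using c by (simp add: near_proper_def)
  have "matched p \<subset> matched q"
  proof (rule psubsetI)
    show "matched p \<subseteq> matched q"
    proof
      fix y assume y: "y \<in> matched p"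
      then have "y \<noteq> a" "y \<noteq> b" using e by (auto simp: matched_def)
      then show "y \<in> matched q" using y oth by (simp add: matched_def)
    qed
    have "a \<in> matched q" "a \<notin> matched p" using e N_V(1) by (auto simp: matched_def)
    then show "matched p \<noteq> matched q" by blast
  qed
  moreover have "finite (matched q)" using fin by (simp add: matched_def)
  ultimately have "card (matched p) < card (matched q)" by (intro psubset_card_mono)
  then obtain y where y: "poor q y" using max_matched[OF vq] by (meson leD)
  have ny: "y \<noteq> a" "y \<noteq> b" using poorD(2)[OF y] e by auto
  have "mates p y = {}" using oth[OF ny] poorD(2)[OF y] by simp
  with y ny show ?thesis by blast
qed

text \<open>As \<open>a\<close> is the only neighbor of \<open>z\<close> in its class and both are
  solo, the move creates exactly one inside edge and destroys none.\<close>

lemma join_mates: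
  assumes "mates p z = {}" "mates p a = {}" "a \<in> N z" "part p z (p a) = {a}"
  shows "mates (p(z := p a)) z = {a}" "mates (p(z := p a)) a = {z}"
    "y \<noteq> z \<Longrightarrow> y \<noteq> a \<Longrightarrow> mates (p(z := p a)) y = mates p y"
proof -
  have za: "z \<in> N a" "z \<noteq> a" using assms(3) nbr_sym nbr_neq by blast+
  show "mates (p(z := p a)) z = {a}" using assms(4) mates_upd_self by simp
  show "mates (p(z := p a)) a = {z}" using assms(2) za by (auto simp: in_mates mates_empty split: if_splits)
  show "mates (p(z := p a)) y = mates p y" if y: "y \<noteq> z" "y \<noteq> a"
  proof -
    have "p y \<noteq> p z" if "z \<in> N y" using assms(1) that nbr_sym by (auto simp: mates_empty)
    moreover have "p y \<noteq> p a" if "z \<in> N y"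
    proof
      assume "p y = p a"
      then have "y \<in> part p z (p a)" using that nbr_sym by (auto simp: in_part)
      then show False using assms(4) y by simp
    qed
    ultimately show ?thesis using y by (auto simp: in_mates split: if_splits)
  qed
qed

text \<open>The new pair of mates brings in \<open>new_poor\<close>. The poor vertex is next to
  \<open>z\<close>, since elsewhere poorness is unaffected.\<close>

lemma join:
  assumes "mates p z = {}" "mates p a = {}" "a \<in> N z" "part p z (p a) = {a}"
  obtains y where "poor (p(z := p a)) y" "y \<in> N z" "mates p y = {}" "y \<noteq> a" "y \<noteq> z"
proof -
  have "in_range (p(z := p a))" using near pK N_V(1)[OF assms(3)] by (intro in_range_upd) (simp_all add: near_proper_def)
  then have "\<exists>y. poor (p(z := p a)) y \<and> mates p y = {} \<and> y \<noteq> a \<and> y \<noteq> z"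
    by (rule new_poor[OF _ assms(3,2,1) join_mates(2,1)[OF assms]]) (rule join_mates(3)[OF assms])
  then obtain y where y: "poor (p(z := p a)) y" "mates p y = {}" "y \<noteq> a" "y \<noteq> z" by blast
  have "y \<in> N z"
  proof (rule ccontr)
    assume "y \<notin> N z"
    then have "z \<notin> N y" using nbr_sym by blast
    then have "poor p y" using y by (intro poor_cong_imp[OF y(1)]) auto
    then show False using not_poor by blast
  qed
  then show ?thesis using that y by blast
qed

text \<open>
  Both possible ways to give \<open>z\<close> a mate make a solo neighbor of \<open>z\<close> poor, but \<open>w\<close> and \<open>t\<close> are the
  only candidates.
\<close>

lemma two_solos:
  assumes "mates p z = {}" "w \<in> N z" "mates p w = {}" "part p z (p w) = {w}" "part p z c = {t}"
    and solos: "\<And>u. u \<in> N z \<Longrightarrow> mates p u = {} \<Longrightarrow> u \<in> {w, t}"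
    and nb: "mates p t = {} \<Longrightarrow> \<not> balanced (p(z := c)) w"
  shows False
proof -
  have t: "t \<in> N z" "p t = c" using assms(5) by (auto simp: part_def)
  show False
  proof (cases "mates p t = {}")
    case True
    obtain y where y: "poor (p(z := p t)) y" "y \<in> N z" "mates p y = {}" "y \<noteq> t"
    proof (rule join[OF assms(1) True t(1)])
      show "part p z (p t) = {t}" using assms(5) t(2) by simp
    qed
    then have "y = w" using solos by blast
    then show False using nb[OF True] poorD(3)[OF y(1)] t(2) by simp
  next
    case False
    obtain y where "y \<in> N z" "mates p y = {}" "y \<noteq> w" by (rule join[OF assms(1,3,2,4)])
    then show False using solos False by blast
  qed
qed

lemma left_upd:
  assumes "balanced (p(z := c)) y" "z \<in> N y" "mates p z = {}" "c \<noteq> p z"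
  shows "part p y (p z) = {z}"
  by (rule left_class[OF assms(1,2,3)]) (use assms(4) in auto)

text \<open>\<open>w1\<close> leaves a class in which it was the only neighbor of \<open>z\<close>
  and enters \<open>C\<close>, where \<open>z\<close> had a single neighbor \<open>t\<close>. Before
  the move, only \<open>w1\<close> and \<open>t\<close> could be solo neighbors of \<open>z\<close>,
  so \<open>two_solos\<close> applies: moving \<open>z\<close> to \<open>C\<close> unbalances
  \<open>w1\<close>, which saw no vertex of \<open>C\<close>.\<close>

lemma merge_A:
  assumes w: "w1 \<in> balanced_solos p" "w2 \<in> balanced_solos p" and C: "part p w1 C = {}" "C \<noteq> p w1"
    and q: "q = p(w1 := C, w2 := C)" and o1: "mates q w1 = {w2}"
    and oth: "\<And>y. y \<noteq> w1 \<Longrightarrow> y \<noteq> w2 \<Longrightarrow> mates q y = mates p y" and ne: "w1 \<noteq> w2"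
    and z: "poor q z" "mates p z = {}" "z \<in> N w1" "z \<notin> N w2"
  shows False
proof -
  have so: "mates p w1 = {}" using w by (simp add: balanced_solos_def)
  have zn: "w1 \<in> N z" "w2 \<notin> N z" using z nbr_sym by blast+
  have L: "part p z (p w1) = {w1}"
    by (rule left_class[OF poorD(3)[OF z(1)] zn(1) so]) (use q C zn ne in auto)
  have q1: "q w1 = C" using q ne by simp
  have "mates q w1 \<inter> N z = {}" using o1 zn(2) by simp
  then obtain t where t: "t \<noteq> w1" "part q z (q w1) = {w1, t}" "\<forall>u\<in>N z. mates q u = {} \<longrightarrow> u \<in> {w1, t}"
      using arrival[OF z(1) zn(1)] by blast
  have "part p z C = part q z C - {w1}" using zn q C by (auto simp: in_part split: if_splits)
  then have p1: "part p z C = {t}" using t q1 by auto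
  have sol: "u \<in> {w1, t}" if "u \<in> N z" "mates p u = {}" for u
  proof (cases "u = w1")
    case False
    moreover have "u \<noteq> w2" using that zn by blast
    ultimately have "mates q u = {}" using oth[of u] that(2) by simp
    then show ?thesis using t(3) that(1) by blast
  qed simp
  show False
  proof (rule two_solos[OF z(2) zn(1) so L p1 sol])
    have "part (p(z := C)) w1 C = {z}" using C(1) z(3) by (auto simp: in_part part_def)
    then show "\<not> balanced (p(z := C)) w1" by (intro odd_not_balanced[of _ _ C]) simp
  qed
qed

text \<open>Instead of the merge, \<open>z\<close> joins \<open>w1\<close>, which creates a poor
  vertex \<open>r\<close>. If \<open>r\<close> is not adjacent to \<open>w1\<close>, then
  \<open>two_solos\<close> applies at \<open>r\<close>. Otherwise \<open>r\<close> joins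
  \<open>z\<close>, which creates a poor vertex \<open>t\<close> not adjacent to \<open>z\<close>,
  and \<open>two_solos\<close> applies at \<open>t\<close>.\<close>

lemma merge_B:
  assumes w: "w1 \<in> balanced_solos p" "w2 \<in> balanced_solos p" "w1 \<in> N w2" and C: "C \<noteq> p w1" "C \<noteq> p w2"
    and q: "q = p(w1 := C, w2 := C)"
    and oth: "\<And>y. y \<noteq> w1 \<Longrightarrow> y \<noteq> w2 \<Longrightarrow> mates q y = mates p y"
    and z: "poor q z" "mates p z = {}" "z \<in> N w1" "z \<in> N w2"
  shows False
proof -
  have so: "mates p w1 = {}" "mates p w2 = {}" "balanced p w1" "balanced p w2" using w by (simp_all add: balanced_solos_def)
  have ne: "w1 \<noteq> w2" "p w1 \<noteq> p w2" using nbr_neq[OF w(3)] solo_adj[OF so(2) w(3)] by auto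
  have zn: "w1 \<in> N z" "w2 \<in> N z" "z \<noteq> w1" "z \<noteq> w2" using z nbr_sym nbr_neq by blast+
  have pz: "p z \<noteq> p w1" "p z \<noteq> p w2" using solo_adj[OF z(2)] zn by blast+
  have "part p z (p w1) = {w1}"
    by (rule left_class[OF poorD(3)[OF z(1)] zn(1) so(1)]) (use q C ne in auto)
  moreover have "part p z (p w2) = {w2}"
    by (rule left_class[OF poorD(3)[OF z(1)] zn(2) so(2)]) (use q C ne in auto)
  ultimately have L: "part p z (p w1) = {w1}" "part p z (p w2) = {w2}" by blast+
  \<comment> \<open>Under \<open>q\<close> these vertices are solo neighbors of the poor vertex
    \<open>z\<close>.\<close>
  have S: "p u = p u'" if "u \<in> N z - {w1, w2}" "mates p u = {}" "u' \<in> N z - {w1, w2}" "mates p u' = {}" for u u'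
  proof -
    have "q u = q u'" using that oth by (intro poor_solos[OF z(1)]) auto
    then show ?thesis using that q by simp
  qed
  \<comment> \<open>Moving \<open>b\<close> alone makes the number of neighbors of \<open>y\<close>
    in class \<open>c\<close> odd.\<close>
  have toggle: "\<not> balanced (p(b := c)) y" if "balanced p y" "b \<in> N y" "p b \<noteq> c" for y b c
  proof -
    have "part (p(b := c)) y c = insert b (part p y c)" using that by (auto simp: in_part split: if_splits)
    then have "odd (card (part (p(b := c)) y c))" using balanced_even[OF that(1), of c] that(3) by (simp add: in_part)
    then show ?thesis by (rule odd_not_balanced)
  qed
  obtain r where r: "poor (p(z := p w1)) r" "r \<in> N z" "mates p r = {}" "r \<noteq> w1" "r \<noteq> z"
    by (rule join[OF z(2) so(1) zn(1) L(1)])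
  note jo = join_mates[OF z(2) so(1) zn(1) L(1)]
  define q1 where "q1 = p(z := p w1)"
  note r1 = r(1)[folded q1_def] and jo1 = jo[folded q1_def]
  have q1z: "q1 z = p w1" "\<And>u. u \<noteq> z \<Longrightarrow> q1 u = p u" by (simp_all add: q1_def)
  have zr: "z \<in> N r" using r(2) nbr_sym by blast
  have rw2: "r \<noteq> w2" using toggle[OF so(4) z(4) pz(1)] poorD(3)[OF r(1)] by blast
  have Lr: "part p r (p z) = {z}" by (rule left_upd[OF poorD(3)[OF r(1)] zr z(2)]) (use pz in simp)
  have pr: "p r \<noteq> p z" using solo_adj[OF z(2) r(2)] by simp
  show False
  proof (cases "r \<in> N w1")
    case False
    then have "w1 \<notin> N r" using nbr_sym by blast
    then have "mates q1 z \<inter> N r = {}" using jo1(1) by simp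
    then obtain t where t: "t \<noteq> z" "part q1 r (q1 z) = {z, t}" "\<forall>u\<in>N r. mates q1 u = {} \<longrightarrow> u \<in> {z, t}"
      using arrival[OF r1 zr] by blast
    have "part p r (p w1) = part q1 r (q1 z) - {z}" using q1z pz by (auto simp: in_part q1_def split: if_splits)
    then have p1: "part p r (p w1) = {t}" using t by auto
    have sol: "u \<in> {z, t}" if "u \<in> N r" "mates p u = {}" for u
    proof (cases "u = z")
      case False
      moreover have "u \<noteq> w1" using that \<open>w1 \<notin> N r\<close> by blast
      ultimately have "mates q1 u = {}" using jo1(3)[of u] that(2) False by simp
      then show ?thesis using t(3) that(1) by blast
    qed simp
    show False
    proof (rule two_solos[OF r(3) zr z(2) Lr p1 sol])
      \<comment> \<open>The move of \<open>r\<close> does not touch class \<open>p w2\<close>, in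
        which \<open>z\<close> has the single neighbor \<open>w2\<close>.\<close>
      have "p r \<noteq> p w2" using L(2) r(2) rw2 by (auto simp: part_def)
      then have "part (p(r := p w1)) z (p w2) = part p z (p w2)"
        using ne by (auto simp: in_part split: if_splits)
      then show "\<not> balanced (p(r := p w1)) z" using L(2) by (intro odd_not_balanced[of _ _ "p w2"]) simp
    qed
  next
    case rw1: True
    obtain t where t: "poor (p(r := p z)) t" "t \<in> N r" "mates p t = {}" "t \<noteq> z" "t \<noteq> r"
      by (rule join[OF r(3) z(2) zr Lr])
    define q2 where "q2 = p(r := p z)"
    note t1 = t(1)[folded q2_def] and jo2 = join_mates[OF r(3) z(2) zr Lr, folded q2_def]
    have rt: "r \<in> N t" using t nbr_sym by blast
    have tw1: "t \<noteq> w1" using toggle[OF so(3) rw1 pr] poorD(3)[OF t(1)] by blast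
    have tw2: "t \<noteq> w2" using toggle[OF so(4) _ pr] rt poorD(3)[OF t(1)] by blast
    have ptr: "p t \<noteq> p r" using solo_adj[OF t(3) rt] .
    \<comment> \<open>If \<open>t\<close> were adjacent to \<open>z\<close>, then by
      \<open>S\<close> the adjacent solo vertices \<open>t\<close> and \<open>r\<close> would share
      a class.\<close>
    have tz: "t \<notin> N z" using S[of t r] t(3) r(2-4) tw1 tw2 rw2 ptr by blast
    then have zt: "z \<notin> N t" using nbr_sym by blast
    have Lt: "part p t (p r) = {r}" by (rule left_upd[OF poorD(3)[OF t(1)] rt r(3)]) (use pr in simp)
    have "mates q2 r \<inter> N t = {}" using jo2(1) zt by simp
    then obtain h where h: "h \<noteq> r" "part q2 t (q2 r) = {r, h}" "\<forall>u\<in>N t. mates q2 u = {} \<longrightarrow> u \<in> {r, h}"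
      using arrival[OF t1 rt] by blast
    have "part p t (p z) = part q2 t (q2 r) - {r}" using pr by (auto simp: in_part q2_def split: if_splits)
    then have p1: "part p t (p z) = {h}" using h by auto
    have sol: "u \<in> {r, h}" if "u \<in> N t" "mates p u = {}" for u
    proof (cases "u = r")
      case False
      moreover have "u \<noteq> z" using that zt by blast
      ultimately have "mates q2 u = {}" using jo2(3)[of u] that(2) False by simp
      then show ?thesis using h(3) that(1) by blast
    qed simp
    show False
    proof (rule two_solos[OF t(3) rt r(3) Lt p1 sol])
      have b1: "balanced q1 r" using poorD(3)[OF r1] .
      have pz': "p t \<noteq> p z" using Lr t(2,4) by (auto simp: part_def)
      \<comment> \<open>Otherwise, after \<open>z\<close> has joined \<open>w1\<close>, this class
        would contain the three neighbors \<open>z\<close>, \<open>w1\<close>, \<open>t\<close> of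
        \<open>r\<close>, whereas balance allows only two in the class of the solo neighbor
        \<open>t\<close>.\<close>
      have pw: "p t \<noteq> p w1"
      proof
        assume e: "p t = p w1"
        have "mates q1 t = {}" using jo1(3)[OF t(4) tw1] t(3) by simp
        then have "card {x \<in> A r. q1 x = q1 t} = 1" by (rule solo_single[OF b1 t(2)])
        then have "card (part q1 r (p t)) = 2" using balanced_card_part[OF b1, of "p t"] q1z(2)[OF t(4)] by simp
        moreover have "{z, w1, t} \<subseteq> part q1 r (p t)"
          using zr rw1 nbr_sym t(2,4) q1z e zn(3) by (auto simp: in_part q1_def)
        then have "card {z, w1, t} \<le> card (part q1 r (p t))" by (intro card_mono) auto
        moreover have "card {z, w1, t} = 3" using zn t(4) tw1 by auto
        ultimately show False by simp
      qed
      \<comment> \<open>The first join does not affect this class around \<open>r\<close>, so it has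
        an even number of vertices there, and the departure of \<open>t\<close> makes the number
        odd.\<close>
      have "part q1 r (p t) = part p r (p t)" using pz' pw by (auto simp: in_part q1_def split: if_splits)
      then have ev: "even (card (part p r (p t)))" using balanced_even[OF b1, of "p t"] by simp
      have eq: "part (p(t := p z)) r (p t) = part p r (p t) - {t}" using pz' by (auto simp: in_part split: if_splits)
      have "t \<in> part p r (p t)" using t(2) by (simp add: in_part)
      then have "Suc (card (part (p(t := p z)) r (p t))) = card (part p r (p t))"
        unfolding eq by (intro card_Suc_Diff1) simp_all
      then have "odd (card (part (p(t := p z)) r (p t)))" using ev by (metis even_Suc)
      then show "\<not> balanced (p(t := p z)) r" by (rule odd_not_balanced)
    qed
  qed
qed

text \<open>Two adjacent balanced solo vertices have a common absent class other than their own.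
  Moving both into it makes them mates and so creates a poor vertex, which is excluded according to
  its adjacency to the two.\<close>

lemma W_independent:
  assumes w: "w1 \<in> balanced_solos p" "w2 \<in> balanced_solos p"
  shows "w1 \<notin> N w2"
proof
  assume ad: "w1 \<in> N w2"
  then have ad': "w2 \<in> N w1" using nbr_sym by blast
  have so: "mates p w1 = {}" "mates p w2 = {}" "balanced p w1" "balanced p w2" using w by (simp_all add: balanced_solos_def)
  have ne: "w1 \<noteq> w2" "p w1 \<noteq> p w2" using nbr_neq[OF ad] solo_adj[OF so(2) ad] by auto
  have cp: "in_range p" using near by (simp add: near_proper_def)
  obtain C where C: "C \<in> absent p w1" "C \<in> absent p w2" "C \<noteq> p w1" "C \<noteq> p w2"
  proof -
    have "2 \<le> card (absent p w2)" using balanced_absent2[OF so(4) cp] .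
    then obtain C where C: "C \<in> absent p w2" "C \<noteq> p w2" using ex_diff[of "{p w2}" 1 "absent p w2"] by auto
    \<comment> \<open>A vertex of class \<open>C\<close> in the clique of \<open>N w1\<close>
      containing \<open>w2\<close> would be seen by \<open>w2\<close>; balance carries the absence
      over to the other clique.\<close>
    have "part p w1 C = {}"
    proof -
      have "u \<notin> side w1 w2" if "p u = C" for u
      proof
        assume "u \<in> side w1 w2"
        then have "u \<in> N w2" using side_cl[OF side_in[OF ad'], of u] that C(2) by blast
        then show False using C(1) that by (auto simp: in_absent)
      qed
      then have e: "{u \<in> side w1 w2. p u = C} = {}" by blast
      then have "{u \<in> opp w1 w2. p u = C} = {}" by (rule balanced_side_empty[OF so(3)])
      with e show ?thesis unfolding part_side(1)[of p w1 C w2] by simp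
    qed
    moreover have "C \<noteq> p w1" using C(1) ad by (auto simp: in_absent)
    ultimately show thesis using C by (intro that) (simp_all add: absent_def)
  qed
  define q where "q = p(w1 := C, w2 := C)"
  have pC: "part p w1 C = {}" "part p w2 C = {}" using C by (simp_all add: absent_def)
  have qq: "q w1 = C" "q w2 = C" "\<And>u. u \<noteq> w1 \<Longrightarrow> u \<noteq> w2 \<Longrightarrow> q u = p u" by (simp_all add: q_def)
  have o1: "mates q w1 = {w2}" using pC ad' ne irr qq by (auto simp: in_mates part_def q_def split: if_splits)
  have o2: "mates q w2 = {w1}" using pC ad ne irr qq by (auto simp: in_mates part_def q_def split: if_splits)
  have oth: "mates q y = mates p y" if "y \<noteq> w1" "y \<noteq> w2" for y
  proof -
    have "p u \<noteq> p y \<and> q u \<noteq> p y" if "u \<in> N y" "u \<in> {w1, w2}" for u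
    proof -
      have "y \<in> N u" "q u = C" using that nbr_sym qq by blast+
      then show ?thesis using that(2) so(1,2) pC by (auto simp: mates_empty part_def)
    qed
    moreover have "q u = p u" if "u \<notin> {w1, w2}" for u using qq(3) that by blast
    ultimately have "q u = p y \<longleftrightarrow> p u = p y" if "u \<in> N y" for u
      using that by (cases "u \<in> {w1, w2}") auto
    then show ?thesis using qq(3)[OF that] by (auto simp: in_mates)
  qed
  have "in_range q" using cp C by (auto simp: q_def absent_def intro!: in_range_upd)
  then obtain z where z: "poor q z" "mates p z = {}" "z \<noteq> w1" "z \<noteq> w2"
    using new_poor[of q w1 w2, OF _ ad so(1,2) o1 o2 oth] by blast
  consider "z \<in> N w1" "z \<in> N w2" | "z \<in> N w1" "z \<notin> N w2" | "z \<notin> N w1" "z \<in> N w2" | "z \<notin> N w1" "z \<notin> N w2"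
    by blast
  then show False
  proof cases
    case 1
    show False by (rule merge_B[OF w ad C(3,4) q_def oth z(1,2) 1])
  next
    case 2
    show False by (rule merge_A[OF w pC(1) C(3) q_def o1 oth ne(1) z(1,2) 2])
  next
    case 3
    have "q = p(w2 := C, w1 := C)" unfolding q_def using ne(1) by (rule fun_upd_twist)
    from merge_A[OF w(2,1) pC(2) C(4) this o2 oth _ z(1,2) 3(2,1)] ne(1) show False by blast
  next
    case 4
    then have "w1 \<notin> N z" "w2 \<notin> N z" using nbr_sym by blast+
    then have "poor p z" using z qq by (intro poor_cong_imp[OF z(1)]) (auto simp: q_def)
    then show False using not_poor by blast
  qed
qed

end

section \<open>Breaking the cycles of a graph of maximum degree two\<close>

text \<open>
  Allowing one deficient set makes the induction work: the representative of the first set occurs in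
  at most one other set, which becomes the deficient one.
\<close>

lemma sdr_one_deficient:
  fixes L :: "'c \<Rightarrow> 'w set"
  assumes "finite CC" "\<And>c. c \<in> CC \<Longrightarrow> c \<noteq> c0 \<Longrightarrow> \<exists>w\<in>L c. \<exists>w'\<in>L c. w \<noteq> w'"
    "c0 \<in> CC \<Longrightarrow> L c0 \<noteq> {}" "\<And>w. card {c \<in> CC. w \<in> L c} \<le> 2"
  shows "\<exists>r. inj_on r CC \<and> (\<forall>c\<in>CC. r c \<in> L c)"
  using assms
proof (induction "card CC" arbitrary: CC L c0)
  case 0
  then show ?case by simp
next
  case (Suc n)
  \<comment> \<open>The deficient set, if present, is represented first.\<close>
  obtain c1 where c1: "c1 \<in> CC" "c0 \<in> CC \<Longrightarrow> c1 = c0"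
  proof (cases "c0 \<in> CC")
    case False
    moreover have "CC \<noteq> {}" using Suc.hyps(2) by auto
    ultimately show thesis using that by blast
  qed (use that in blast)
  have "L c1 \<noteq> {}" using Suc.prems(2)[OF c1(1)] Suc.prems(3) c1(1) by blast
  then obtain w where w: "w \<in> L c1" by blast
  let ?C = "CC - {c1}" and ?L = "\<lambda>c. L c - {w}"
  have two: "\<exists>u\<in>L c. \<exists>u'\<in>L c. u \<noteq> u'" if "c \<in> ?C" for c
    using Suc.prems(2)[of c] that c1(2) by blast
  have "card {c \<in> ?C. w \<in> L c} < card {c \<in> CC. w \<in> L c}"
    using w c1(1) Suc.prems(1) by (intro psubset_card_mono) auto
  then have "card {c \<in> ?C. w \<in> L c} \<le> Suc 0" using Suc.prems(4)[of w] by linarith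
  then have "\<forall>c\<in>{c \<in> ?C. w \<in> L c}. \<forall>c'\<in>{c \<in> ?C. w \<in> L c}. c = c'"
    using Suc.prems(1) by (subst (asm) card_le_Suc0_iff_eq) auto
  then obtain c2 where c2: "c \<in> ?C \<Longrightarrow> w \<in> L c \<Longrightarrow> c = c2" for c by blast
  have "\<exists>r. inj_on r ?C \<and> (\<forall>c\<in>?C. r c \<in> ?L c)"
  proof (rule Suc.hyps(1)[of ?C c2 ?L])
    show "n = card ?C" using Suc.hyps(2) c1(1) Suc.prems(1) by simp
    show "finite ?C" using Suc.prems(1) by simp
    show "\<exists>u\<in>?L c. \<exists>u'\<in>?L c. u \<noteq> u'" if "c \<in> ?C" "c \<noteq> c2" for c
    proof -
      have "?L c = L c" using c2[OF that(1)] that(2) by blast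
      then show ?thesis using two[OF that(1)] by simp
    qed
    show "?L c2 \<noteq> {}" if "c2 \<in> ?C" using two[OF that] by blast
    show "card {c \<in> ?C. u \<in> ?L c} \<le> 2" for u
    proof -
      have "card {c \<in> ?C. u \<in> ?L c} \<le> card {c \<in> CC. u \<in> L c}"
        using Suc.prems(1) by (intro card_mono) auto
      then show ?thesis using Suc.prems(4)[of u] by linarith
    qed
  qed
  then obtain r where r: "inj_on r ?C" "\<And>c. c \<in> ?C \<Longrightarrow> r c \<in> ?L c" by blast
  have "inj_on (r(c1 := w)) CC"
  proof (rule inj_onI)
    fix c d assume cd: "c \<in> CC" "d \<in> CC" "(r(c1 := w)) c = (r(c1 := w)) d"
    have ne: "r e \<noteq> w" if "e \<in> CC" "e \<noteq> c1" for e using r(2)[of e] that by blast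
    show "c = d"
    proof (cases "c = c1 \<or> d = c1")
      case True
      then show ?thesis using cd ne[of c] ne[of d] by (auto split: if_splits)
    next
      case False
      then show ?thesis using cd inj_onD[OF r(1), of c d] by simp
    qed
  qed
  moreover have "(r(c1 := w)) c \<in> L c" if "c \<in> CC" for c using that r(2)[of c] w by simp
  ultimately show ?case by blast
qed

text \<open>Edges are abstract items with endpoint sets, so parallel edges are possible.\<close>

locale labelled_edges =
  fixes E :: "'e set" and ends :: "'e \<Rightarrow> 'a set" and lab :: "'e \<Rightarrow> 'w option"
  assumes finE: "finite E"
    and ends2: "e \<in> E \<Longrightarrow> card (ends e) = 2"
    and deg2: "card {e \<in> E. x \<in> ends e} \<le> 2"
begin

definition good :: "('a \<Rightarrow> bool) \<Rightarrow> 'e \<Rightarrow> bool" where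
  "good b e \<longleftrightarrow> (\<forall>x\<in>ends e. \<forall>y\<in>ends e. x \<noteq> y \<longrightarrow> b x \<noteq> b y)"

lemma goodD: "good b e \<Longrightarrow> x \<in> ends e \<Longrightarrow> y \<in> ends e \<Longrightarrow> x \<noteq> y \<Longrightarrow> b x \<noteq> b y"
  unfolding good_def by blast

text \<open>These are the nonempty unions of cycles, where two parallel edges form a cycle.\<close>

definition closed :: "'e set \<Rightarrow> bool" where
  "closed C \<longleftrightarrow> C \<subseteq> E \<and> C \<noteq> {} \<and> (\<forall>e\<in>C. \<forall>x\<in>ends e. card {e \<in> C. x \<in> ends e} = 2)"

definition mincl :: "'e set set" where
  "mincl = {C. closed C \<and> (\<forall>C'. C' \<subset> C \<longrightarrow> \<not> closed C')}"

lemma closed_deg: "closed C \<Longrightarrow> e \<in> C \<Longrightarrow> x \<in> ends e \<Longrightarrow> card {e \<in> C. x \<in> ends e} = 2"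
  unfolding closed_def by blast

text \<open>A vertex touched by \<open>C\<close> has two edges in \<open>C\<close>, and by
  \<open>deg2\<close> there is no third one.\<close>

lemma closed_all:
  assumes "closed C" "e \<in> C" "x \<in> ends e" "f \<in> E" "x \<in> ends f" shows "f \<in> C"
proof -
  have "{e \<in> C. x \<in> ends e} \<subseteq> {e \<in> E. x \<in> ends e}" using assms(1) by (auto simp: closed_def)
  moreover have "card {e \<in> E. x \<in> ends e} \<le> card {e \<in> C. x \<in> ends e}"
    using deg2[of x] assms(1-3) by (simp add: closed_def)
  ultimately have "{e \<in> C. x \<in> ends e} = {e \<in> E. x \<in> ends e}" using finE by (intro card_seteq) auto
  then show ?thesis using assms(4,5) by blast
qed

text \<open>By \<open>closed_all\<close> the intersection is closed, and minimality makes it equal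
  to both sets.\<close>

lemma mincl_disjoint:
  assumes "C \<in> mincl" "C' \<in> mincl" "e \<in> C" "e \<in> C'" shows "C = C'"
proof -
  have c: "closed C" "closed C'" using assms by (auto simp: mincl_def)
  have "card {f \<in> C \<inter> C'. x \<in> ends f} = 2" if g: "g \<in> C \<inter> C'" "x \<in> ends g" for g x
  proof -
    have "{f \<in> C \<inter> C'. x \<in> ends f} = {f \<in> C. x \<in> ends f}"
      using closed_all[OF c(2) _ g(2)] g(1) c(1) by (auto simp: closed_def)
    then show ?thesis using closed_deg[OF c(1) _ g(2)] g(1) by (simp only: Int_iff)
  qed
  then have "closed (C \<inter> C')"
    unfolding closed_def using c(1) assms(3,4) by (intro conjI ballI) (auto simp: closed_def)
  then have "\<not> C \<inter> C' \<subset> C" "\<not> C \<inter> C' \<subset> C'" using assms(1,2) by (auto simp: mincl_def)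
  then show ?thesis by blast
qed

lemma closed_mincl: "closed C \<Longrightarrow> \<exists>C'\<in>mincl. C' \<subseteq> C"
proof -
  assume c: "closed C"
  obtain C' where C': "closed C' \<and> C' \<subseteq> C" "\<And>X. closed X \<and> X \<subseteq> C \<Longrightarrow> card C' \<le> card X"
    using ex_has_least_nat[of "\<lambda>X. closed X \<and> X \<subseteq> C" C card] c by blast
  have "\<not> closed X" if "X \<subset> C'" for X
  proof
    assume "closed X"
    then have "card C' \<le> card X" using C' that by blast
    moreover have "finite C'" using C'(1) finE by (auto simp: closed_def intro: finite_subset)
    ultimately show False using psubset_card_mono[OF _ that] by simp
  qed
  then show ?thesis using C'(1) by (auto simp: mincl_def)
qed

text \<open>A nonempty \<open>F\<close> without closed subsets has a vertex \<open>x\<close> on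
  exactly one edge. After this edge is removed and the induction hypothesis applied, the bit of
  \<open>x\<close> can be chosen freely.\<close>

lemma peel:
  assumes "F \<subseteq> E" "\<And>C. C \<subseteq> F \<Longrightarrow> \<not> closed C"
  shows "\<exists>b :: 'a \<Rightarrow> bool. \<forall>e\<in>F. good b e"
  using assms
proof (induction "card F" arbitrary: F)
  case 0
  then show ?case using finite_subset[OF 0(2) finE] by simp
next
  case (Suc n)
  have fF: "finite F" using Suc.prems(1) finE by (rule finite_subset)
  have "F \<noteq> {}" using Suc.hyps(2) by auto
  then obtain g x where g: "g \<in> F" "x \<in> ends g" "card {e \<in> F. x \<in> ends e} \<noteq> 2"
    using Suc.prems unfolding closed_def by blast
  have "card {e \<in> F. x \<in> ends e} \<le> card {e \<in> E. x \<in> ends e}"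
    using Suc.prems(1) finE by (intro card_mono) auto
  then have "card {e \<in> F. x \<in> ends e} \<le> Suc 0" using deg2[of x] g(3) by linarith
  then have only: "e = g" if "e \<in> F" "x \<in> ends e" for e
    using that g(1,2) fF by (subst (asm) card_le_Suc0_iff_eq) auto
  have "card (ends g) = 2" using g(1) Suc.prems(1) ends2 by blast
  then obtain u v where uv: "ends g = {u, v}" "u \<noteq> v" by (auto simp: card_2_iff)
  obtain y where y: "ends g = {x, y}" "x \<noteq> y"
  proof (cases "x = u")
    case False
    then have "ends g = {x, u}" "x \<noteq> u" using uv g(2) by auto
    then show thesis by (rule that)
  qed (use uv that in blast)
  have "\<exists>b :: 'a \<Rightarrow> bool. \<forall>e\<in>F - {g}. good b e"
    using Suc.prems Suc.hyps(2) g(1) fF by (intro Suc.hyps(1)) auto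
  then obtain b where b: "\<And>e. e \<in> F - {g} \<Longrightarrow> good b e" by blast
  let ?b = "b(x := \<not> b y)"
  have "good ?b e" if e: "e \<in> F" for e
  proof (cases "e = g")
    case True
    have "?b x \<noteq> ?b y" using y(2) by simp
    then show ?thesis unfolding good_def True y(1) by blast
  next
    case False
    then have eq: "?b u = b u" if "u \<in> ends e" for u using only[OF e] that by auto
    have gb: "good b e" using b e False by blast
    show ?thesis
      unfolding good_def
    proof (intro ballI impI)
      fix u v assume "u \<in> ends e" "v \<in> ends e" "u \<noteq> v"
      then show "?b u \<noteq> ?b v" using goodD[OF gb] by (simp only: eq not_False_eq_True)
    qed
  qed
  then show ?case by blast
qed

text \<open>
  Minimal closed sets are the edge sets of cycles. They are disjoint, so a label with two edges
  meets at most two of them, and they have a system of distinct labels; one edge with that label is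
  dropped from each.
\<close>

lemma bits:
  assumes two: "\<And>C. closed C \<Longrightarrow> \<exists>e\<in>C. \<exists>e'\<in>C. \<exists>w w'. lab e = Some w \<and> lab e' = Some w' \<and> w \<noteq> w'"
    and lab2: "\<And>w. card {e \<in> E. lab e = Some w} \<le> 2"
  shows "\<exists>b :: 'a \<Rightarrow> bool.
    (\<forall>e\<in>E. lab e = None \<longrightarrow> good b e) \<and>
    (\<forall>e\<in>E. \<forall>f\<in>E. e \<noteq> f \<longrightarrow> lab e \<noteq> None \<longrightarrow> lab f = lab e \<longrightarrow>
      (\<exists>g\<in>{e, f}. good b g))"
proof -
  define L where "L C = {w. \<exists>e\<in>C. lab e = Some w}" for C
  have mE: "C \<subseteq> E" if "C \<in> mincl" for C using that by (simp add: mincl_def closed_def)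
  have fin: "finite mincl" by (rule finite_subset[of _ "Pow E"]) (use mE finE in auto)
  have "\<exists>r. inj_on r mincl \<and> (\<forall>c\<in>mincl. r c \<in> L c)"
  \<comment> \<open>The deficient index is set to \<open>{}\<close>, which is not closed, so every
    set in the family has two labels.\<close>
  proof (rule sdr_one_deficient[OF fin, of "{}"])
    show "\<exists>w\<in>L C. \<exists>w'\<in>L C. w \<noteq> w'" if "C \<in> mincl" for C
    proof -
      have "closed C" using that by (simp add: mincl_def)
      then show ?thesis using two[of C] unfolding L_def by blast
    qed
    show "L {} \<noteq> {}" if "{} \<in> mincl" using that by (simp add: mincl_def closed_def)
    show "card {C \<in> mincl. w \<in> L C} \<le> 2" for w
    proof -
      \<comment> \<open>Distinct cycles are disjoint, so picking an edge with label \<open>w\<close>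
        from each of them is injective.\<close>
      define f where "f C = (SOME e. e \<in> C \<and> lab e = Some w)" for C
      have f: "f C \<in> C \<and> lab (f C) = Some w" if "w \<in> L C" for C
      proof -
        have "\<exists>e. e \<in> C \<and> lab e = Some w" using that by (auto simp: L_def)
        then show ?thesis unfolding f_def by (rule someI_ex)
      qed
      have "inj_on f {C \<in> mincl. w \<in> L C}"
      proof (rule inj_onI)
        fix C C' assume a: "C \<in> {C \<in> mincl. w \<in> L C}" "C' \<in> {C \<in> mincl. w \<in> L C}" "f C = f C'"
        then show "C = C'" using mincl_disjoint[of C C' "f C"] f[of C] f[of C'] by simp
      qed
      moreover have "f ` {C \<in> mincl. w \<in> L C} \<subseteq> {e \<in> E. lab e = Some w}" using f mE by blast
      ultimately have "card {C \<in> mincl. w \<in> L C} \<le> card {e \<in> E. lab e = Some w}"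
        using finE by (intro card_inj_on_le) auto
      then show ?thesis using lab2[of w] by linarith
    qed
  qed
  then obtain r where r: "inj_on r mincl" "\<And>C. C \<in> mincl \<Longrightarrow> r C \<in> L C" by blast
  then have "\<forall>C\<in>mincl. \<exists>e\<in>C. lab e = Some (r C)" by (simp add: L_def)
  then obtain d where d: "\<And>C. C \<in> mincl \<Longrightarrow> d C \<in> C \<and> lab (d C) = Some (r C)" by metis
  let ?F = "E - d ` mincl"
  have "\<not> closed C" if "C \<subseteq> ?F" for C
  proof
    assume "closed C"
    then obtain C' where "C' \<in> mincl" "C' \<subseteq> C" using closed_mincl by blast
    then show False using d[of C'] that by blast
  qed
  then obtain b :: "'a \<Rightarrow> bool" where b: "\<forall>e\<in>?F. good b e"
    using peel[of ?F] by blast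
  have hard: "e \<in> ?F" if "e \<in> E" "lab e = None" for e using that d by auto
  \<comment> \<open>Distinct cycles drop edges with distinct labels, so each label loses at most one
    edge.\<close>
  have soft: "e \<in> ?F \<or> f \<in> ?F" if e: "e \<in> E" "f \<in> E" "e \<noteq> f" "lab e \<noteq> None" "lab f = lab e" for e f
  proof (rule ccontr)
    assume "\<not> ?thesis"
    then obtain C C' where C: "C \<in> mincl" "e = d C" "C' \<in> mincl" "f = d C'" using e by blast
    then have "r C = r C'" using d[OF C(1)] d[OF C(3)] e(5) by simp
    then have "C = C'" using inj_onD[OF r(1)] C by blast
    then show False using C e(3) by blast
  qed
  show ?thesis
  proof (intro exI[of _ b] conjI ballI impI)
    fix e assume "e \<in> E" "lab e = None"
    then show "good b e" by (rule b[rule_format, OF hard])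
  next
    fix e f assume "e \<in> E" "f \<in> E" "e \<noteq> f" "lab e \<noteq> None" "lab f = lab e"
    then have "e \<in> ?F \<or> f \<in> ?F" by (rule soft)
    then show "\<exists>g\<in>{e, f}. good b g"
    proof
      assume "e \<in> ?F" then have "good b e" using b by (rule bspec[rotated])
      then show ?thesis by simp
    next
      assume "f \<in> ?F" then have "good b f" using b by (rule bspec[rotated])
      then show ?thesis by simp
    qed
  qed
qed

end

section \<open>Choosing the bits\<close>

definition pcf :: "'a set \<Rightarrow> ('a \<Rightarrow> 'a set) \<Rightarrow> ('a \<Rightarrow> nat) \<Rightarrow> bool" where
  "pcf V N c \<longleftrightarrow> (\<forall>v\<in>V. \<forall>u\<in>N v. c u \<noteq> c v) \<and>
    (\<forall>v\<in>V. N v \<noteq> {} \<longrightarrow> (\<exists>u\<in>N v. \<forall>u'\<in>N v. c u' = c u \<longrightarrow> u' = u))"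

context optimal_classes
begin

lemma mates_single: "u \<in> mates p v \<Longrightarrow> mates p v = {u}"
proof -
  assume u: "u \<in> mates p v"
  have "card (mates p v) \<le> Suc 0" using near by (simp add: near_proper_def)
  then have "w = u" if "w \<in> mates p v" for w using u that by (subst (asm) card_le_Suc0_iff_eq) auto
  then show ?thesis using u by blast
qed

lemma WsetD: "w \<in> balanced_solos p \<Longrightarrow> mates p w = {}" "w \<in> balanced_solos p \<Longrightarrow> balanced p w" "w \<in> balanced_solos p \<Longrightarrow> N w \<noteq> {}"
  by (simp_all add: balanced_solos_def)

lemma two_singles:
  assumes "w \<in> balanced_solos p"
  shows "\<exists>c c'. c \<noteq> c' \<and> card {u \<in> A w. p u = c} = 1 \<and> card {u \<in> A w. p u = c'} = 1"
  using not_poor[of w] WsetD[OF assms] unfolding poor_def by blast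

lemma sing_pair:
  assumes "w \<in> balanced_solos p" "card {u \<in> A w. p u = c} = 1"
  shows "\<exists>x\<in>A w. \<exists>y\<in>B w. part p w c = {x, y} \<and> x \<noteq> y \<and> p x = c \<and> p y = c"
proof -
  have "card {u \<in> B w. p u = c} = 1" using balancedD[OF WsetD(2)[OF assms(1)], of c] assms(2) by simp
  then obtain y where y: "{u \<in> B w. p u = c} = {y}" by (auto simp: card_1_singleton_iff)
  obtain x where x: "{u \<in> A w. p u = c} = {x}" using assms(2) by (auto simp: card_1_singleton_iff)
  have "x \<in> A w" "p x = c" "y \<in> B w" "p y = c" using x y by blast+
  moreover have "part p w c = {u \<in> A w. p u = c} \<union> {u \<in> B w. p u = c}" using N_eq[of w] by (auto simp: part_def)
  moreover have "x \<noteq> y" using calculation(1,3) disj[of w] by blast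
  ultimately show ?thesis unfolding x y by (metis insert_is_Un)
qed

lemma fin_W: "finite {w \<in> balanced_solos p. x \<in> N w \<and> P w}"
  by (rule finite_subset[of _ "N x"]) (use nbr_sym in auto)

text \<open>By independence each of the cliques \<open>A x\<close> and \<open>B x\<close> contains
  at most one balanced solo vertex.\<close>

lemma card_W: "card {w \<in> balanced_solos p. x \<in> N w} \<le> 2"
proof -
  have ind: "w = w'" if "w \<in> balanced_solos p" "w' \<in> balanced_solos p" "w \<noteq> w' \<Longrightarrow> w' \<in> N w" for w w'
    using W_independent that by blast
  have "card (A x \<inter> balanced_solos p) \<le> Suc 0" "card (B x \<inter> balanced_solos p) \<le> Suc 0"
    using ind clA clB by (subst card_le_Suc0_iff_eq; force)+
  moreover have "{w \<in> balanced_solos p. x \<in> N w} = (A x \<inter> balanced_solos p) \<union> (B x \<inter> balanced_solos p)"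
    using N_eq[of x] nbr_sym[of _ x] by auto
  ultimately show ?thesis using card_Un_le[of "A x \<inter> balanced_solos p" "B x \<inter> balanced_solos p"] by simp
qed

text \<open>The vertices counted here lie in the clique of \<open>N x\<close> opposite to
  \<open>x'\<close>, which by independence contains at most one of them.\<close>

lemma card_W_matched:
  assumes "x' \<in> mates p x" shows "card {w \<in> balanced_solos p. x \<in> N w \<and> x' \<notin> N w} \<le> 1"
proof -
  have xx: "x' \<in> N x" using assms by (simp add: in_mates)
  have opp: "w \<in> opp x x'" if w: "w \<in> balanced_solos p" "x \<in> N w" "x' \<notin> N w" for w
  proof -
    have wx: "w \<in> N x" "w \<notin> N x'" using w nbr_sym by blast+
    have "w \<noteq> x'" using WsetD(1)[OF w(1)] assms in_mates_sym by blast
    then have "w \<notin> side x x'" using side_cl[OF side_in[OF xx], of w] wx by blast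
    then show ?thesis using wx side_opp(1)[of x x'] by simp
  qed
  have "w = w'" if w: "w \<in> balanced_solos p" "x \<in> N w" "x' \<notin> N w" and w': "w' \<in> balanced_solos p" "x \<in> N w'" "x' \<notin> N w'" for w w'
    using opp_cl[OF opp[OF w] opp[OF w']] W_independent[OF w'(1) w(1)] by blast
  then have "\<forall>a\<in>{w \<in> balanced_solos p. x \<in> N w \<and> x' \<notin> N w}. \<forall>b\<in>{w \<in> balanced_solos p. x \<in> N w \<and> x' \<notin> N w}. a = b"
    by blast
  then show ?thesis using fin_W by (simp add: card_le_Suc0_iff_eq)
qed

lemma bits_exist:
  "\<exists>b :: 'a \<Rightarrow> bool. (\<forall>v. \<forall>u\<in>mates p v. b u \<noteq> b v) \<and>
    (\<forall>w\<in>balanced_solos p. \<exists>x y. x \<noteq> y \<and> part p w (p x) = {x, y} \<and> b x \<noteq> b y)"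
proof -
  \<comment> \<open>Around any other balanced solo vertex, two mates in opposite cliques already
    receive different bits, so only the vertices in \<open>Wp\<close> need alternatives.\<close>
  define Wp where "Wp = {w \<in> balanced_solos p. \<forall>x\<in>A w. mates p x \<inter> B w = {}}"
  have WpW: "w \<in> balanced_solos p" if "w \<in> Wp" for w using that by (simp add: Wp_def)
  have Wp: False if "w \<in> Wp" "x \<in> A w" "y \<in> mates p x" "y \<in> B w" for w x y using that unfolding Wp_def by blast
  have "\<forall>w. \<exists>s. w \<in> balanced_solos p \<longrightarrow>
      fst s \<noteq> snd s \<and> card {u \<in> A w. p u = fst s} = 1 \<and> card {u \<in> A w. p u = snd s} = 1"
  proof
    fix w
    show "\<exists>s. w \<in> balanced_solos p \<longrightarrow>
      fst s \<noteq> snd s \<and> card {u \<in> A w. p u = fst s} = 1 \<and> card {u \<in> A w. p u = snd s} = 1"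
    proof (cases "w \<in> balanced_solos p")
      case True
      then obtain c c' where "c \<noteq> c' \<and> card {u \<in> A w. p u = c} = 1 \<and> card {u \<in> A w. p u = c'} = 1"
        using two_singles by blast
      then show ?thesis by (intro exI[of _ "(c, c')"]) simp
    qed simp
  qed
  from choice[OF this] obtain s where s: "\<forall>w. w \<in> balanced_solos p \<longrightarrow>
      fst (s w) \<noteq> snd (s w) \<and> card {u \<in> A w. p u = fst (s w)} = 1 \<and> card {u \<in> A w. p u = snd (s w)} = 1" ..
  define s1 s2 where "s1 w = fst (s w)" and "s2 w = snd (s w)" for w
  have ss: "s1 w \<noteq> s2 w \<and> card {u \<in> A w. p u = s1 w} = 1 \<and> card {u \<in> A w. p u = s2 w} = 1"
    if "w \<in> balanced_solos p" for w
    using s[rule_format, OF that] unfolding s1_def s2_def .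
  \<comment> \<open>The first component is the label, namely the vertex that owns the alternative,
    or \<open>None\<close> for a pair of mates. It also keeps requirements with equal endpoints
    apart.\<close>
  define soft where "soft = {(Some w, part p w c) | w c. w \<in> Wp \<and> c \<in> {s1 w, s2 w}}"
  define hard where "hard = {(None :: 'a option, {x, y}) | x y. y \<in> mates p x}"
  have pair: "\<exists>x\<in>A w. \<exists>y\<in>B w. part p w c = {x, y} \<and> x \<noteq> y \<and> p x = c \<and> p y = c \<and> y \<notin> mates p x"
    if w: "w \<in> Wp" "c \<in> {s1 w, s2 w}" for w c
  proof -
    have "card {u \<in> A w. p u = c} = 1" using ss[OF WpW[OF w(1)]] w(2) by blast
    from sing_pair[OF WpW[OF w(1)] this] show ?thesis using Wp[OF w(1)] by blast
  qed
  have inc: "(\<exists>x'\<in>mates p x. e = (None, {x, x'})) \<or> (\<exists>w\<in>Wp. x \<in> N w \<and> p x \<in> {s1 w, s2 w} \<and> e = (Some w, part p w (p x)))"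
    if e: "e \<in> hard \<union> soft" "x \<in> snd e" for e x
  proof (cases "e \<in> hard")
    case True
    then obtain a c where ac: "e = (None, {a, c})" "c \<in> mates p a" by (auto simp: hard_def)
    then have "x = a \<or> x = c" using e(2) by simp
    then show ?thesis
    proof
      assume "x = c"
      then have "a \<in> mates p x" "e = (None, {x, a})" using ac in_mates_sym by (simp_all add: insert_commute)
      then show ?thesis by blast
    qed (use ac in blast)
  next
    case False
    then obtain w c where wc: "e = (Some w, part p w c)" "w \<in> Wp" "c \<in> {s1 w, s2 w}"
      using e(1) by (auto simp: soft_def)
    then have "x \<in> N w" "p x = c" using e(2) by (simp_all add: in_part)
    then show ?thesis using wc by blast
  qed
  interpret le: labelled_edges "hard \<union> soft" snd fst
  proof
    have "hard \<union> soft \<subseteq> insert None (Some ` V) \<times> Pow V"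
    proof
      fix e assume "e \<in> hard \<union> soft"
      then show "e \<in> insert None (Some ` V) \<times> Pow V"
      proof
        assume "e \<in> hard"
        then show ?thesis using N_V by (auto simp: hard_def in_mates)
      next
        assume "e \<in> soft"
        then obtain w c where "e = (Some w, part p w c)" "w \<in> balanced_solos p" using WpW by (auto simp: soft_def)
        moreover from this have "w \<in> V" using WsetD(3) N_V(2) by blast
        ultimately show ?thesis using N_V(1) by (auto simp: part_def)
      qed
    qed
    then show "finite (hard \<union> soft)" by (rule finite_subset) (use fin in simp)
  next
    fix e assume "e \<in> hard \<union> soft"
    then show "card (snd e) = 2"
    proof
      assume "e \<in> hard"
      then obtain x y where e: "e = (None, {x, y})" "y \<in> mates p x" by (auto simp: hard_def)
      then have "x \<noteq> y" using irr by (auto simp: in_mates)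
      then show ?thesis using e by simp
    next
      assume "e \<in> soft"
      then obtain w c where wc: "e = (Some w, part p w c)" "w \<in> Wp" "c \<in> {s1 w, s2 w}" by (auto simp: soft_def)
      from pair[OF wc(2,3)] obtain x y where "part p w c = {x, y}" "x \<noteq> y" by blast
      then show ?thesis using wc by simp
    qed
  next
    fix x
    let ?H = "(\<lambda>x'. (None :: 'a option, {x, x'})) ` mates p x"
    \<comment> \<open>Of the two alternatives of \<open>w\<close>, only one in the class of
      \<open>x\<close> can contain \<open>x\<close>, so each \<open>w\<close> contributes at most
      one edge at \<open>x\<close>.\<close>
    let ?Wx = "{w \<in> Wp. x \<in> N w \<and> p x \<in> {s1 w, s2 w}}"
    let ?S = "(\<lambda>w. (Some w, part p w (p x))) ` ?Wx"
    have Wx: "?Wx \<subseteq> {w \<in> balanced_solos p. x \<in> N w}" using WpW by blast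
    have finWx: "finite ?Wx" using Wx fin_W[of x "\<lambda>_. True"] by (simp add: finite_subset)
    have "{e \<in> hard \<union> soft. x \<in> snd e} \<subseteq> ?H \<union> ?S" using inc by blast
    then have "card {e \<in> hard \<union> soft. x \<in> snd e} \<le> card (?H \<union> ?S)" using finWx by (intro card_mono) auto
    also have "\<dots> \<le> card ?H + card ?S" by (rule card_Un_le)
    also have "\<dots> \<le> card (mates p x) + card ?Wx" using finWx by (intro add_mono card_image_le) auto
    also have "\<dots> \<le> 2"
    proof (cases "mates p x = {}")
      case True
      have "card ?Wx \<le> card {w \<in> balanced_solos p. x \<in> N w}" using Wx fin_W[of x "\<lambda>_. True"] by (intro card_mono) auto
      then show ?thesis using True card_W[of x] by simp
    next
      case False
      then obtain x' where x': "x' \<in> mates p x" by blast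
      \<comment> \<open>With \<open>x'\<close> also around \<open>w\<close>, the alternative would
        consist of two mates in opposite cliques, against the choice of \<open>Wp\<close>. So a
        matched vertex lies on one hard and at most one soft edge.\<close>
      have "x' \<notin> N w" if w: "w \<in> Wp" "x \<in> N w" "p x \<in> {s1 w, s2 w}" for w
      proof
        assume "x' \<in> N w"
        obtain a b where ab: "a \<in> A w" "b \<in> B w" "part p w (p x) = {a, b}" using pair[OF w(1,3)] by blast
        have "x \<in> part p w (p x)" "x' \<in> part p w (p x)" using w(2) \<open>x' \<in> N w\<close> x' by (auto simp: in_part in_mates)
        moreover have "x \<noteq> x'" using x' irr by (auto simp: in_mates)
        ultimately have "x = a \<and> x' = b \<or> x = b \<and> x' = a" unfolding ab(3) by blast
        moreover have "x \<in> mates p x'" using x' in_mates_sym by blast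
        ultimately show False using Wp[OF w(1)] ab x' by blast
      qed
      then have "?Wx \<subseteq> {w \<in> balanced_solos p. x \<in> N w \<and> x' \<notin> N w}" using WpW by blast
      then have "card ?Wx \<le> card {w \<in> balanced_solos p. x \<in> N w \<and> x' \<notin> N w}" using fin_W by (intro card_mono) auto
      then have "card ?Wx \<le> 1" using card_W_matched[OF x'] by linarith
      moreover have "card (mates p x) = 1" using mates_single[OF x'] by simp
      ultimately show ?thesis by linarith
    qed
    finally show "card {e \<in> hard \<union> soft. x \<in> snd e} \<le> 2" .
  qed
  have other: "\<exists>f\<in>C. f \<noteq> e \<and> x \<in> snd f" if C: "le.closed C" "e \<in> C" "x \<in> snd e" for C e x
  proof (rule ccontr)
    assume "\<not> ?thesis"
    then have "{f \<in> C. x \<in> snd f} = {e}" using C by blast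
    then show False using le.closed_deg[OF C] by simp
  qed
  have labs: "\<exists>e\<in>C. \<exists>e'\<in>C. \<exists>w w'. fst e = Some w \<and> fst e' = Some w' \<and> w \<noteq> w'" if C: "le.closed C" for C
  proof -
    have CE: "C \<subseteq> hard \<union> soft" "C \<noteq> {}" using C by (simp_all add: le.closed_def)
    \<comment> \<open>At either end a hard edge continues in a soft one, because a vertex has only
      one mate.\<close>
    have "\<exists>e\<in>C. e \<in> soft"
    proof -
      obtain e where e: "e \<in> C" using CE by blast
      show ?thesis
      proof (cases "e \<in> soft")
        case False
        then have "e \<in> hard" using e CE by blast
        then obtain x y where xy: "e = (None, {x, y})" "y \<in> mates p x" by (auto simp: hard_def)
        then obtain f where f: "f \<in> C" "f \<noteq> e" "x \<in> snd f" using other[OF C e, of x] by auto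
        have "f \<notin> hard"
        proof
          assume "f \<in> hard"
          then have "fst f = None" by (auto simp: hard_def)
          then obtain x' where "x' \<in> mates p x" "f = (None, {x, x'})" 
            using inc[OF subsetD[OF CE(1) f(1)] f(3)] by auto
          then show False using f(2) xy mates_single[OF xy(2)] by simp
        qed
        then show ?thesis using f CE by blast
      qed (use e in blast)
    qed
    then obtain e w c where e: "e \<in> C" "e = (Some w, part p w c)" "w \<in> Wp" "c \<in> {s1 w, s2 w}" by (auto simp: soft_def)
    obtain x y where xy: "x \<in> A w" "y \<in> B w" "part p w c = {x, y}" "p x = c" "y \<notin> mates p x"
      using pair[OF e(3,4)] by blast
    show ?thesis
    proof (rule ccontr)
      \<comment> \<open>If \<open>w\<close> is the only label, the cycle through the soft edge
        \<open>{x, y}\<close> leaves \<open>x\<close> by a hard edge to \<open>x'\<close> and leaves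
        \<open>x'\<close> by a soft edge of \<open>w\<close>. Mates share a class, so this soft edge
        is again \<open>{x, y}\<close> and \<open>x' = y\<close>, although \<open>y\<close> is not a
        mate of \<open>x\<close>.\<close>
      assume no: "\<not> ?thesis"
      have same: "w' = w" if "(Some w', S) \<in> C" for w' S using no that e(1,2) by force
      have "x \<in> snd e" using e xy by simp
      then obtain f where f: "f \<in> C" "f \<noteq> e" "x \<in> snd f" using other[OF C e(1)] by blast
      then obtain x' where x': "x' \<in> mates p x" "f = (None, {x, x'})"
        using inc[OF subsetD[OF CE(1) f(1)] f(3)] same[of _ "part p _ (p x)"] f(1,2) e(2) xy(4) by blast
      have "x' \<in> snd f" using x' by simp
      then obtain f' where f': "f' \<in> C" "f' \<noteq> f" "x' \<in> snd f'" using other[OF C f(1)] by blast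
      have xo: "mates p x' = {x}" using x'(1) in_mates_sym mates_single by blast
      have "f' \<noteq> (None, {x', z})" if "z \<in> mates p x'" for z
        using that xo f'(2) x'(2) by (auto simp: insert_commute)
      then have "x' \<in> N w" "f' = (Some w, part p w (p x'))" 
        using inc[OF subsetD[OF CE(1) f'(1)] f'(3)] same[of _ "part p _ (p x')"] f'(1) by blast+
      moreover have "p x' = c" using x'(1) xy(4) by (simp add: in_mates)
      ultimately have "x' \<in> part p w c" by (simp add: in_part)
      then have "x' \<in> {x, y}" by (simp only: xy(3))
      moreover have "x' \<noteq> x" using x'(1) irr by (auto simp: in_mates)
      ultimately have "x' = y" by blast
      then show False using xy(5) x'(1) by simp
    qed
  qed
  have lab2: "card {e \<in> hard \<union> soft. fst e = Some w} \<le> 2" for w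
  proof -
    have "{e \<in> hard \<union> soft. fst e = Some w} \<subseteq> {(Some w, part p w (s1 w)), (Some w, part p w (s2 w))}"
      by (auto simp: hard_def soft_def)
    then have "card {e \<in> hard \<union> soft. fst e = Some w} \<le> card {(Some w, part p w (s1 w)), (Some w, part p w (s2 w))}"
      by (intro card_mono) auto
    also have "\<dots> \<le> 2" by (rule order.trans[OF card_insert_le_m1]) auto
    finally show ?thesis .
  qed
  obtain b :: "'a \<Rightarrow> bool" where b1: "\<And>e. e \<in> hard \<Longrightarrow> le.good b e"
    and b2: "\<And>e f. e \<in> soft \<Longrightarrow> f \<in> soft \<Longrightarrow> e \<noteq> f \<Longrightarrow> fst f = fst e \<Longrightarrow> \<exists>g\<in>{e, f}. le.good b g"
  proof -
    have "\<exists>b :: 'a \<Rightarrow> bool.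
      (\<forall>e\<in>hard \<union> soft. fst e = None \<longrightarrow> le.good b e) \<and>
      (\<forall>e\<in>hard \<union> soft. \<forall>f\<in>hard \<union> soft. e \<noteq> f \<longrightarrow> fst e \<noteq> None \<longrightarrow> fst f = fst e \<longrightarrow> (\<exists>g\<in>{e, f}. le.good b g))"
      by (rule le.bits[OF _ lab2]) (rule labs)
    then obtain b :: "'a \<Rightarrow> bool" where b:
      "\<forall>e\<in>hard \<union> soft. fst e = None \<longrightarrow> le.good b e"
      "\<forall>e\<in>hard \<union> soft. \<forall>f\<in>hard \<union> soft. e \<noteq> f \<longrightarrow> fst e \<noteq> None \<longrightarrow> fst f = fst e \<longrightarrow> (\<exists>g\<in>{e, f}. le.good b g)"
      by (elim exE conjE)
    show thesis
    proof (rule that)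
      show "le.good b e" if "e \<in> hard" for e
        using b(1)[rule_format, of e] that by (auto simp: hard_def)
      show "\<exists>g\<in>{e, f}. le.good b g" if e: "e \<in> soft" "f \<in> soft" "e \<noteq> f" "fst f = fst e" for e f
      proof -
        have "fst e \<noteq> None" using e(1) by (auto simp: soft_def)
        from b(2)[rule_format, OF _ _ e(3) this e(4)] e(1,2) show ?thesis by blast
      qed
    qed
  qed
  have mates_b: "b u \<noteq> b v" if "u \<in> mates p v" for u v
  proof -
    have "(None, {v, u}) \<in> hard" using that by (auto simp: hard_def)
    then have g: "le.good b (None, {v, u})" by (rule b1)
    have "u \<noteq> v" using that irr by (auto simp: in_mates)
    then show ?thesis using le.goodD[OF g, of u v] by simp
  qed
  have W_b: "\<exists>x y. x \<noteq> y \<and> part p w (p x) = {x, y} \<and> b x \<noteq> b y" if w: "w \<in> balanced_solos p" for w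
  proof (cases "w \<in> Wp")
    case True
    let ?e = "(Some w, part p w (s1 w))" and ?f = "(Some w, part p w (s2 w))"
    have "?e \<in> soft" "?f \<in> soft" using True by (auto simp: soft_def)
    moreover have "?e \<noteq> ?f"
    proof
      assume "?e = ?f"
      moreover obtain x where "x \<in> part p w (s1 w)" using pair[OF True, of "s1 w"] by auto
      ultimately have "x \<in> part p w (s1 w)" "x \<in> part p w (s2 w)" by simp_all
      then show False using ss[OF w] by (simp add: in_part)
    qed
    ultimately obtain g where "g \<in> {?e, ?f}" "le.good b g" using b2[of ?e ?f] by auto
    then obtain c where c: "c \<in> {s1 w, s2 w}" "le.good b (Some w, part p w c)" by blast
    obtain x y where "part p w c = {x, y}" "x \<noteq> y" "p x = c" using pair[OF True c(1)] by blast
    then show ?thesis using le.goodD[OF c(2), of x y] by (intro exI[of _ x] exI[of _ y]) simp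
  next
    case False
    then obtain x y where xy: "x \<in> A w" "y \<in> mates p x" "y \<in> B w" using w by (auto simp: Wp_def)
    have opp: "mates p x = {y}" "mates p y = {x}" using xy(2) in_mates_sym mates_single by blast+
    have pxy: "p y = p x" using xy(2) by (simp add: in_mates)
    \<comment> \<open>A third vertex of this class around \<open>w\<close> would be a second mate of
      \<open>x\<close> or \<open>y\<close>, whichever lies in its clique.\<close>
    have "u \<in> {x, y}" if u: "u \<in> N w" "p u = p x" for u
    proof (rule ccontr)
      assume n: "u \<notin> {x, y}"
      consider "u \<in> A w" | "u \<in> B w" using u N_eq[of w] by blast
      then show False
      proof cases
        case 1
        then have "u \<in> mates p x" using clA[OF xy(1), of u] n u by (auto simp: in_mates)
        then show False using opp n by simp
      next
        case 2
        then have "u \<in> mates p y" using clB[OF xy(3), of u] n u pxy by (auto simp: in_mates)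
        then show False using opp n by simp
      qed
    qed
    then have "part p w (p x) \<subseteq> {x, y}" unfolding part_def by blast
    moreover have "x \<in> part p w (p x)" "y \<in> part p w (p x)"
      using A_nbr[OF xy(1)] B_nbr[OF xy(3)] pxy by (simp_all add: in_part)
    ultimately have "part p w (p x) = {x, y}" by blast
    moreover have "b x \<noteq> b y" using mates_b[OF xy(2)] by simp
    ultimately show ?thesis by (intro exI[of _ x] exI[of _ y]) auto
  qed
  show ?thesis by (intro exI[of _ b] conjI allI ballI mates_b W_b)
qed

lemma pcf_exists: "\<exists>c. (\<forall>v\<in>V. c v < D + 4) \<and> pcf V N c"
proof -
  obtain b :: "'a \<Rightarrow> bool" where bb: "\<forall>v. \<forall>u\<in>mates p v. b u \<noteq> b v"
    "\<forall>w\<in>balanced_solos p. \<exists>x y. x \<noteq> y \<and> part p w (p x) = {x, y} \<and> b x \<noteq> b y"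
    using bits_exist by (elim exE conjE)
  note b = bb(1)[rule_format] and bW = bb(2)[rule_format]
  define c where "c v = 2 * p v + (if b v then 1 else 0)" for v
  have ceq: "c u = c v \<longleftrightarrow> p u = p v \<and> b u = b v" for u v
    unfolding c_def by (cases "b u"; cases "b v") (simp_all, presburger+)
  have "c v < D + 4" if "v \<in> V" for v
    using pK[OF that] by (auto simp: c_def K_def)
  moreover have "c u \<noteq> c v" if "u \<in> N v" for u v
    using b[of u v] that by (auto simp: ceq in_mates)
  moreover have "\<exists>u\<in>N v. \<forall>u'\<in>N v. c u' = c u \<longrightarrow> u' = u" if ne: "N v \<noteq> {}" for v
  proof -
    \<comment> \<open>Bits are injective on a class within a clique. If \<open>X\<close> has more
      vertices of class \<open>d\<close> than \<open>Y\<close>, some bit occurs in \<open>X\<close>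
      but not in \<open>Y\<close>, and its color is seen once.\<close>
    have uneq: "\<exists>u\<in>N v. \<forall>u'\<in>N v. c u' = c u \<longrightarrow> u' = u"
      if X: "N v = X \<union> Y" "\<And>u w. u \<in> X \<Longrightarrow> w \<in> X \<Longrightarrow> u \<noteq> w \<Longrightarrow> w \<in> N u"
        and Y: "\<And>u w. u \<in> Y \<Longrightarrow> w \<in> Y \<Longrightarrow> u \<noteq> w \<Longrightarrow> w \<in> N u"
        and lt: "card {u \<in> Y. p u = d} < card {u \<in> X. p u = d}" for X Y d
    proof -
      have inj: "inj_on b {u \<in> Z. p u = d}" if "\<And>u w. u \<in> Z \<Longrightarrow> w \<in> Z \<Longrightarrow> u \<noteq> w \<Longrightarrow> w \<in> N u" for Z
      proof (rule inj_onI)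
        fix u w assume a: "u \<in> {u \<in> Z. p u = d}" "w \<in> {u \<in> Z. p u = d}" "b u = b w"
        show "u = w"
        proof (rule ccontr)
          assume "u \<noteq> w"
          then have "w \<in> mates p u" using that[of u w] a by (simp add: in_mates)
          then show False using b[of w u] a(3) by simp
        qed
      qed
      have iX: "inj_on b {u \<in> X. p u = d}" by (rule inj) (rule X(2))
      have iY: "inj_on b {u \<in> Y. p u = d}" by (rule inj) (rule Y)
      have fY: "finite {u \<in> Y. p u = d}" by (rule finite_subset[OF _ finN(1)[of v]]) (use X(1) in blast)
      have "\<not> b ` {u \<in> X. p u = d} \<subseteq> b ` {u \<in> Y. p u = d}"
      proof
        assume "b ` {u \<in> X. p u = d} \<subseteq> b ` {u \<in> Y. p u = d}"
        then have "card (b ` {u \<in> X. p u = d}) \<le> card (b ` {u \<in> Y. p u = d})"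
          using fY by (intro card_mono) auto
        then show False using lt card_image[OF iX] card_image[OF iY] by simp
      qed
      then obtain u where u: "u \<in> X" "p u = d" "b u \<notin> b ` {u \<in> Y. p u = d}" by blast
      have "u' = u" if u': "u' \<in> N v" "c u' = c u" for u'
      proof -
        have e: "p u' = d" "b u' = b u" using u'(2) u(2) by (simp_all add: ceq)
        then have "u' \<notin> Y" using u(3) by force
        then have "u' \<in> X" using u'(1) X(1) by blast
        then show ?thesis using inj_onD[OF iX, of u' u] e u by simp
      qed
      then show ?thesis using u(1) X(1) by blast
    qed
    show ?thesis
    proof (cases "mates p v = {}")
      case False
      then obtain y where y: "y \<in> mates p v" by blast
      have "u = y" if "u \<in> N v" "c u = c y" for u
      proof -
        have "u \<in> mates p v" using that y by (simp add: ceq in_mates)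
        then show ?thesis using mates_single[OF y] by simp
      qed
      then show ?thesis using y by (auto simp: in_mates)
    next
      case solo: True
      show ?thesis
      proof (cases "balanced p v")
        case True
        then have "v \<in> balanced_solos p" using solo ne by (simp add: balanced_solos_def)
        then obtain x y where xy: "x \<noteq> y" "part p v (p x) = {x, y}" "b x \<noteq> b y" using bW by blast
        have "x \<in> N v" using xy(2) by (auto simp: part_def)
        moreover have "u = x" if "u \<in> N v" "c u = c x" for u
        proof -
          have "u \<in> part p v (p x)" using that by (simp add: ceq in_part)
          then have "u \<in> {x, y}" by (simp only: xy(2))
          then show ?thesis using that(2) xy(3) by (auto simp: ceq)
        qed
        ultimately show ?thesis by blast
      next
        case False
        then obtain d where "card {u \<in> A v. p u = d} \<noteq> card {u \<in> B v. p u = d}" by (auto simp: balanced_def)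
        then consider "card {u \<in> B v. p u = d} < card {u \<in> A v. p u = d}" |
          "card {u \<in> A v. p u = d} < card {u \<in> B v. p u = d}" by linarith
        then show ?thesis
        proof cases
          case 1
          show ?thesis by (rule uneq[OF N_eq clA clB 1])
        next
          case 2
          have "N v = B v \<union> A v" using N_eq[of v] by blast
          from uneq[OF this clB clA 2] show ?thesis .
        qed
      qed
    qed
  qed
  ultimately show ?thesis unfolding pcf_def by blast
qed

end

context clique_cover
begin

lemma pcf_exists: "\<exists>c. (\<forall>v\<in>V. c v < D + 4) \<and> pcf V N c"
proof -
  obtain p0 where p0: "near_proper p0 \<and> (\<forall>v. \<not> poor p0 v)" using ex_no_poor by blast
  have bnd: "\<forall>q. near_proper q \<and> (\<forall>v. \<not> poor q v) \<longrightarrow> card (matched q) < Suc (card V)"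
    using fin by (auto simp: matched_def less_Suc_eq_le intro: card_mono)
  obtain p where p: "near_proper p \<and> (\<forall>v. \<not> poor p v)"
    "\<forall>q. near_proper q \<and> (\<forall>v. \<not> poor q v) \<longrightarrow> card (matched q) \<le> card (matched p)"
    using ex_has_greatest_nat[where f = "\<lambda>q. card (matched q)", OF p0 bnd] by blast
  interpret optimal_classes V N A B D p
    by unfold_locales (use p in blast)+
  show ?thesis by (rule pcf_exists)
qed

end

section \<open>Bypassing vertices of degree two\<close>

definition is_clique :: "('a \<Rightarrow> 'a set) \<Rightarrow> 'a set \<Rightarrow> bool" where
  "is_clique N P \<longleftrightarrow> (\<forall>u\<in>P. \<forall>w\<in>P. u \<noteq> w \<longrightarrow> w \<in> N u)"

lemma is_cliqueD: "is_clique N P \<Longrightarrow> u \<in> P \<Longrightarrow> w \<in> P \<Longrightarrow> u \<noteq> w \<Longrightarrow> w \<in> N u"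
  unfolding is_clique_def by blast

locale quasi_line_nbhds =
  fixes V :: "'a set" and N :: "'a \<Rightarrow> 'a set" and D :: nat
  assumes fin: "finite V"
    and N_sub: "N v \<subseteq> V"
    and sym: "u \<in> N v \<Longrightarrow> v \<in> N u"
    and irr: "v \<notin> N v"
    and two: "\<exists>P Q. N v = P \<union> Q \<and> is_clique N P \<and> is_clique N Q"
    and deg: "card (N v) \<le> D"
begin

lemma finN: "finite (N v)"
  using N_sub fin by (rule finite_subset)

text \<open>\<open>A v\<close> is chosen as all of \<open>N v\<close> whenever that is a clique. Two
  cliques of one vertex each then mean two nonadjacent neighbors, which the assumption
  excludes.\<close>

lemma pcf_no_path:
  assumes not_poor: "\<And>u x y. N u = {x, y} \<Longrightarrow> x \<noteq> y \<Longrightarrow> y \<in> N x"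
  shows "\<exists>c. (\<forall>v\<in>V. c v < D + 4) \<and> pcf V N c"
proof -
  have "\<forall>v. \<exists>P. is_clique N P \<and> P \<subseteq> N v \<and> is_clique N (N v - P) \<and> (is_clique N (N v) \<longrightarrow> P = N v)"
  proof
    fix v
    show "\<exists>P. is_clique N P \<and> P \<subseteq> N v \<and> is_clique N (N v - P) \<and> (is_clique N (N v) \<longrightarrow> P = N v)"
    proof (cases "is_clique N (N v)")
      case True
      then show ?thesis by (intro exI[of _ "N v"]) (simp add: is_clique_def)
    next
      case False
      obtain P Q where PQ: "N v = P \<union> Q" "is_clique N P" "is_clique N Q" using two[of v] by blast
      have "N v - P \<subseteq> Q" using PQ(1) by blast
      then have "is_clique N (N v - P)" using PQ(3) unfolding is_clique_def by blast
      then show ?thesis using PQ(1,2) False by (intro exI[of _ P]) simp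
    qed
  qed
  from choice[OF this] obtain A where A: "\<forall>v. is_clique N (A v) \<and> A v \<subseteq> N v \<and> is_clique N (N v - A v) \<and>
      (is_clique N (N v) \<longrightarrow> A v = N v)" ..
  define B where "B v = N v - A v" for v
  have A1: "is_clique N (A v)" "A v \<subseteq> N v" "is_clique N (B v)" "is_clique N (N v) \<Longrightarrow> A v = N v" for v
    using A by (simp_all add: B_def)
  interpret clique_cover V N A B D
  proof
    show "N v = A v \<union> B v" for v using A1(2)[of v] by (auto simp: B_def)
    show "A v \<inter> B v = {}" for v by (auto simp: B_def)
    show "w \<in> N u" if "u \<in> A v" "w \<in> A v" "u \<noteq> w" for u v w by (rule is_cliqueD[OF A1(1) that])
    show "w \<in> N u" if "u \<in> B v" "w \<in> B v" "u \<noteq> w" for u v w by (rule is_cliqueD[OF A1(3) that])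
    show "\<not> (card (A v) = 1 \<and> card (B v) = 1)" for v
    proof
      assume "card (A v) = 1 \<and> card (B v) = 1"
      then obtain x y where xy: "A v = {x}" "B v = {y}" by (auto simp: card_1_singleton_iff)
      then have N: "N v = {x, y}" "x \<noteq> y" using A1(2)[of v] by (auto simp: B_def)
      then have "y \<in> N x" by (rule not_poor)
      then have "is_clique N (N v)" using sym N by (auto simp: is_clique_def)
      then show False using A1(4)[of v] xy N by simp
    qed
  qed (use fin N_sub sym irr deg in auto)
  show ?thesis by (rule pcf_exists)
qed

text \<open>A clique in \<open>N x\<close> that contains \<open>u\<close> is \<open>{u}\<close>, because \<open>y\<close> is not adjacent to \<open>x\<close>.\<close>

lemma path_clique:
  assumes "N u = {x, y}" "y \<notin> N x" shows "is_clique N (N x - {u})"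
proof -
  obtain P Q where PQ: "N x = P \<union> Q" "is_clique N P" "is_clique N Q" using two[of x] by blast
  have sub: "R \<subseteq> {u}" if R: "u \<in> R" "is_clique N R" "R \<subseteq> N x" for R
  proof
    fix w assume w: "w \<in> R"
    show "w \<in> {u}"
    proof (rule ccontr)
      assume "w \<notin> {u}"
      then have "w \<in> N u" using is_cliqueD[OF R(2,1) w] by blast
      then have "w = x \<or> w = y" by (simp add: assms(1))
      moreover have "w \<in> N x" using w R(3) by blast
      ultimately show False using assms(2) irr by blast
    qed
  qed
  have "u \<in> N x" by (rule sym) (simp add: assms(1))
  then have "N x - {u} \<subseteq> Q \<or> N x - {u} \<subseteq> P" using sub[of P] sub[of Q] PQ by blast
  then show ?thesis using PQ(2,3) unfolding is_clique_def by blast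
qed

end

text \<open>By \<open>path_clique\<close> the new neighborhoods of \<open>x\<close> and
  \<open>y\<close> are a clique plus one vertex. Their sizes do not grow, since \<open>u\<close> is
  exchanged for the other end; all remaining neighborhoods do not contain \<open>u\<close> and keep
  their cliques.\<close>

lemma (in quasi_line_nbhds) bypass:
  assumes u: "N u = {x, y}" "x \<noteq> y" "y \<notin> N x"
  defines "N' \<equiv> (\<lambda>v. if v = u then {} else if v = x then insert y (N x - {u})
      else if v = y then insert x (N y - {u}) else N v)"
  shows "quasi_line_nbhds (V - {u}) N' D"
proof -
  have u': "x \<notin> N y" using sym u(3) by blast
  have xy: "x \<in> N u" "y \<in> N u" by (simp_all add: u(1))
  have xyu: "u \<in> N x" "u \<in> N y" "x \<noteq> u" "y \<noteq> u" using sym xy irr by blast+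
  have oth: "u \<notin> N v" if "v \<noteq> x" "v \<noteq> y" for v
  proof
    assume "u \<in> N v"
    then have "v \<in> N u" by (rule sym)
    then show False using that by (simp add: u(1))
  qed
  have N'u: "N' u = {}" by (simp add: N'_def)
  have N'x: "N' x = insert y (N x - {u})" using xyu by (simp add: N'_def)
  have N'y: "N' y = insert x (N y - {u})" using xyu u(2) by (simp add: N'_def)
  have N'o: "N' v = N v" if "v \<noteq> u" "v \<noteq> x" "v \<noteq> y" for v using that by (simp add: N'_def)
  have sup: "w \<in> N' v" if "w \<in> N v" "w \<noteq> u" "v \<noteq> u" for v w
    using that by (auto simp: N'_def)
  have sub: "w \<in> N v \<and> w \<noteq> u \<and> v \<noteq> u \<or> v = x \<and> w = y \<or> v = y \<and> w = x" if "w \<in> N' v" for v w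
    using that oth[of v] by (auto simp: N'_def split: if_splits)
  have up: "is_clique N' P" if "is_clique N P" "u \<notin> P" for P
    unfolding is_clique_def
  proof (intro ballI impI)
    fix a b assume ab: "a \<in> P" "b \<in> P" "a \<noteq> b"
    show "b \<in> N' a" by (rule sup[OF is_cliqueD[OF that(1) ab]]) (use ab that in auto)
  qed
  have cx: "is_clique N (N x - {u})" using path_clique[OF u(1,3)] .
  have cy: "is_clique N (N y - {u})" by (rule path_clique[of u y x]) (use u u' in \<open>auto simp: insert_commute\<close>)
  have xyV: "x \<in> V" "y \<in> V" "u \<in> V" using N_sub xy xyu(1) by blast+
  show ?thesis
  proof
    show "finite (V - {u})" using fin by simp
    show "N' v \<subseteq> V - {u}" for v
    proof
      fix w assume "w \<in> N' v"
      from sub[OF this] show "w \<in> V - {u}" using N_sub[of v] xyV xyu by blast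
    qed
    show "v \<in> N' w" if "w \<in> N' v" for v w
    proof -
      have "y \<in> N' x" "x \<in> N' y" by (simp_all add: N'x N'y)
      with sub[OF that] sup[of v w] sym[of w v] show ?thesis by blast
    qed
    show "v \<notin> N' v" for v using sub[of v v] irr[of v] u(2) by blast
    show "\<exists>P Q. N' v = P \<union> Q \<and> is_clique N' P \<and> is_clique N' Q" for v
    proof -
      consider "v = u" | "v = x" | "v = y" | "v \<noteq> u" "v \<noteq> x" "v \<noteq> y" by blast
      then show ?thesis
      proof cases
        case 1
        then show ?thesis using N'u by (intro exI[of _ "{}"]) (simp add: is_clique_def)
      next
        case 2
        then show ?thesis using N'x up[OF cx] by (intro exI[of _ "{y}"] exI[of _ "N x - {u}"]) (simp add: is_clique_def)
      next
        case 3
        then show ?thesis using N'y up[OF cy] by (intro exI[of _ "{x}"] exI[of _ "N y - {u}"]) (simp add: is_clique_def)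
      next
        case 4
        obtain P Q where PQ: "N v = P \<union> Q" "is_clique N P" "is_clique N Q" using two[of v] by blast
        have u: "u \<notin> P" "u \<notin> Q" using oth[OF 4(2,3)] PQ(1) by blast+
        show ?thesis
          using N'o[OF 4] PQ(1) up[OF PQ(2) u(1)] up[OF PQ(3) u(2)] by (intro exI[of _ P] exI[of _ Q]) simp
      qed
    qed
    show "card (N' v) \<le> D" for v
    proof -
      have le: "card (insert a (N v - {u})) \<le> card (N v)" if "u \<in> N v" for a v
      proof -
        have "card (insert a (N v - {u})) \<le> Suc (card (N v - {u}))" by (rule card_insert_le_m1) auto
        also have "\<dots> = card (N v)" by (rule card_Suc_Diff1[OF finN that])
        finally show ?thesis .
      qed
      have "card (N' v) \<le> card (N v)"
        using le[OF xyu(1), of y] le[OF xyu(2), of x] by (auto simp: N'_def)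
      then show ?thesis using deg[of v] by linarith
    qed
  qed
qed

text \<open>The added edge gives \<open>x\<close> and \<open>y\<close> different colors, so
  \<open>u\<close> sees each once. At each end, \<open>u\<close> avoids the color of one further
  neighbor if there is one; that color stays unique there because the neighbors other than
  \<open>u\<close> form a clique.\<close>

lemma (in quasi_line_nbhds) extend_bypass:
  assumes u: "N u = {x, y}" "x \<noteq> y" "y \<notin> N x"
    and c: "\<forall>v\<in>V - {u}. c v < D + 4"
    and pc: "pcf (V - {u}) (\<lambda>v. if v = u then {} else if v = x then insert y (N x - {u})
      else if v = y then insert x (N y - {u}) else N v) c"
  shows "\<exists>c. (\<forall>v\<in>V. c v < D + 4) \<and> pcf V N c"
proof -
  define N' where "N' v = (if v = u then {} else if v = x then insert y (N x - {u})
      else if v = y then insert x (N y - {u}) else N v)" for v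
  have pc: "pcf (V - {u}) N' c" using pc unfolding N'_def .
  have u': "x \<notin> N y" using sym u(3) by blast
  have xy: "x \<in> N u" "y \<in> N u" by (simp_all add: u(1))
  have xyu: "u \<in> N x" "u \<in> N y" "x \<noteq> u" "y \<noteq> u" using sym xy irr by blast+
  have oth: "u \<notin> N v" if "v \<noteq> x" "v \<noteq> y" for v
  proof
    assume "u \<in> N v"
    then have "v \<in> N u" by (rule sym)
    then show False using that by (simp add: u(1))
  qed
  have sup: "w \<in> N' v" if "w \<in> N v" "w \<noteq> u" "v \<noteq> u" for v w
    using that by (auto simp: N'_def)
  have cx: "is_clique N (N x - {u})" using path_clique[OF u(1,3)] .
  have cy: "is_clique N (N y - {u})" by (rule path_clique[of u y x]) (use u u' in \<open>auto simp: insert_commute\<close>)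
  have xyV: "x \<in> V" "y \<in> V" "u \<in> V" using N_sub xy xyu(1) by blast+
  \<comment> \<open>If \<open>u\<close> is the only neighbor of \<open>v\<close>, then
    \<open>k v\<close> is arbitrary, and its color is merely one more to avoid.\<close>
  define k where "k v = (SOME w. w \<in> N v - {u})" for v
  have k: "k v \<in> N v - {u}" if "N v - {u} \<noteq> {}" for v
    unfolding k_def by (rule someI_ex) (use that in blast)
  let ?F = "{c x, c y, c (k x), c (k y)}"
  have "card ?F \<le> 4" by (intro card_insert_le_m1) auto
  \<comment> \<open>This gives \<open>D \<ge> 2\<close>, so some color lies outside the at most four
    forbidden ones.\<close>
  moreover have "card (N u) = 2" using u by simp
  ultimately have "card ?F < card {..<D + 4}" using deg[of u] by simp
  then obtain d where d: "d < D + 4" "d \<notin> ?F"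
    using card_mono[of ?F "{..<D + 4}"] by (meson finite.emptyI finite_insert leD lessThan_iff subsetI)
  define c' where "c' = c(u := d)"
  have c'u: "c' u = d" and c'o: "\<And>w. w \<noteq> u \<Longrightarrow> c' w = c w" by (simp_all add: c'_def)
  have cne: "c w \<noteq> c v" if "w \<in> N' v" "v \<in> V" "v \<noteq> u" for v w
    using pc that unfolding pcf_def by blast
  have cne': "c' w \<noteq> c' v" if w: "w \<in> N v" for v w
  proof -
    consider "v = u" | "w = u" | "v \<noteq> u" "w \<noteq> u" by blast
    then show ?thesis
    proof cases
      case 1
      then show ?thesis using w u(1) d(2) xyu by (auto simp: c'_def)
    next
      case 2
      then have "v \<in> {x, y}" using oth[of v] w by blast
      then show ?thesis using 2 d(2) xyu by (auto simp: c'_def)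
    next
      case 3
      have "v \<in> V" using sym[OF w] N_sub by blast
      then show ?thesis using cne[OF sup[OF w 3(2,1)] _ 3(1)] 3 by (simp add: c'_def)
    qed
  qed
  have end_vertex: "\<exists>w\<in>N v. \<forall>w'\<in>N v. c' w' = c' w \<longrightarrow> w' = w"
    if v: "u \<in> N v" "is_clique N (N v - {u})" "d \<noteq> c (k v)" for v
  proof (cases "N v - {u} = {}")
    case True
    then show ?thesis using v(1) by blast
  next
    case False
    note kv = k[OF False]
    have "w = k v" if w: "w \<in> N v" "c' w = c' (k v)" for w
    proof (rule ccontr)
      assume ne: "w \<noteq> k v"
      have "w \<noteq> u" using w(2) v(3) kv by (auto simp: c'_def)
      then have "w \<in> N (k v)" using is_cliqueD[OF v(2) kv _ ne[symmetric]] w(1) by blast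
      from cne'[OF this] w(2) show False by simp
    qed
    then show ?thesis using kv by blast
  qed
  have "\<exists>w\<in>N v. \<forall>w'\<in>N v. c' w' = c' w \<longrightarrow> w' = w" if v: "v \<in> V" "N v \<noteq> {}" for v
  proof -
    consider "v = u" | "v = x" | "v = y" | "v \<noteq> u" "v \<noteq> x" "v \<noteq> y" by blast
    then show ?thesis
    proof cases
      case 1
      have "c x \<noteq> c y" using cne[of y x] xyV xyu by (simp add: N'_def)
      then have "c' y \<noteq> c' x" using xyu by (simp add: c'_def)
      then show ?thesis unfolding 1 u(1) by auto
    next
      case 2
      show ?thesis unfolding 2 by (rule end_vertex[OF xyu(1) cx]) (use d in auto)
    next
      case 3
      show ?thesis unfolding 3 by (rule end_vertex[OF xyu(2) cy]) (use d in auto)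
    next
      case 4
      have N: "N' v = N v" using 4 by (simp add: N'_def)
      have "v \<in> V - {u}" using v(1) 4(1) by blast
      then obtain w where w: "w \<in> N v" "\<forall>w'\<in>N v. c w' = c w \<longrightarrow> w' = w"
        using pc v(2) N unfolding pcf_def by metis
      have "c' w' = c w'" if "w' \<in> N v" for w' using oth[OF 4(2,3)] that by (intro c'o) blast
      then show ?thesis using w by (intro bexI[of _ w]) auto
    qed
  qed
  then have "pcf V N c'" using cne' unfolding pcf_def by blast
  moreover have "\<forall>v\<in>V. c' v < D + 4" using c d(1) by (auto simp: c'_def)
  ultimately show ?thesis by blast
qed

section \<open>Induction on the number of vertices and transfer to pair graphs\<close>

lemma quasi_line_nbhds_pcf:
  "quasi_line_nbhds V N D \<Longrightarrow> \<exists>c. (\<forall>v\<in>V. c v < D + 4) \<and> pcf V N c"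
proof (induction "card V" arbitrary: V N rule: less_induct)
  case less
  interpret quasi_line_nbhds V N D by (rule less.prems)
  show ?case
  proof (cases "\<exists>u x y. N u = {x, y} \<and> x \<noteq> y \<and> y \<notin> N x")
    case True
    then obtain u x y where u: "N u = {x, y}" "x \<noteq> y" "y \<notin> N x" by blast
    have "u \<in> N x" by (rule sym) (simp add: u(1))
    then have "u \<in> V" using N_sub by blast
    then have "card (V - {u}) < card V" using fin by (intro psubset_card_mono) auto
    from less.hyps[OF this bypass[OF u]] show ?thesis using extend_bypass[OF u] by blast
  next
    case False
    show ?thesis by (rule pcf_no_path) (use False in blast)
  qed
qed

theorem theorem1p10:
  fixes G :: "'a pair_pre_digraph"
  assumes "pair_graph G"
    and "quasi_line G"
  shows "chi_pcf G \<le> max_degree G + 4"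
proof -
  interpret pair_graph G by (rule assms(1))
  have nV: "nbhd G v \<subseteq> pverts G" for v by (auto simp: nbhd_def dest: in_arcsD2)
  \<comment> \<open>The locale speaks about all elements of the vertex type, so the clique cover and
    the degree bound are needed outside the graph as well.\<close>
  have nO: "nbhd G v = {}" if "v \<notin> pverts G" for v using that by (auto simp: nbhd_def dest: in_arcsD1)
  have "quasi_line_nbhds (pverts G) (nbhd G) (max_degree G)"
  proof
    show "finite (pverts G)" by (rule pair_finite_verts)
    show "nbhd G v \<subseteq> pverts G" for v by (rule nV)
    show "v \<in> nbhd G u" if "u \<in> nbhd G v" for u v
      using that arcs_symmetric by (auto simp: nbhd_def)
    show "v \<notin> nbhd G v" for v using pair_no_loops[of "(v, v)"] by (auto simp: nbhd_def)
    show "\<exists>P Q. nbhd G v = P \<union> Q \<and> is_clique (nbhd G) P \<and> is_clique (nbhd G) Q" for v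
    proof (cases "v \<in> pverts G")
      case True
      then obtain A B where "clique G A" "clique G B" "nbhd G v = A \<union> B"
        using assms(2) unfolding quasi_line_def by blast
      then show ?thesis by (intro exI[of _ A] exI[of _ B]) (auto simp: clique_def is_clique_def nbhd_def)
    next
      case False
      then show ?thesis using nO by (intro exI[of _ "{}"]) (simp add: is_clique_def)
    qed
    show "card (nbhd G v) \<le> max_degree G" for v
    proof (cases "v \<in> pverts G")
      case True
      then show ?thesis unfolding max_degree_def using pair_finite_verts by (intro Max_ge) auto
    qed (simp add: nO)
  qed
  then obtain c where c: "\<forall>v\<in>pverts G. c v < max_degree G + 4" "pcf (pverts G) (nbhd G) c"
    using quasi_line_nbhds_pcf by blast
  have "proper_coloring G c"
    unfolding proper_coloring_def
  proof (clarify)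
    fix u w assume a: "(u, w) \<in> parcs G" "c u = c w"
    then have "u \<in> pverts G" "w \<in> nbhd G u" by (auto simp: nbhd_def dest: in_arcsD1)
    then show False using c(2) a(2) unfolding pcf_def by metis
  qed
  moreover have "\<exists>a. \<exists>!u. u \<in> nbhd G v \<and> c u = a" if "v \<in> pverts G" "nbhd G v \<noteq> {}" for v
    using c(2) that unfolding pcf_def by metis
  ultimately have "pcf_coloring G c" by (simp add: pcf_coloring_def)
  then have "pcf_colorable G (max_degree G + 4)"
    unfolding pcf_colorable_def using c(1) by (intro exI[of _ c]) auto
  then show ?thesis unfolding chi_pcf_def by (rule Least_le)
qed

end
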